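(* Let $\sigma>1$ be an integer, $\omega$ a primitive $\sigma$-th root of unity, $X$ an indeterminate, $G$ a matrix of rank $r$ with column set $E$, and $\mathbb{A}$ of order $q$, in the setting described in the context. For $k=0,\dots,\sigma-1$ let $\mathcal{H}(k,\sigma)$ be the set of flows $h$ of $G$ over $\mathbb{A}$ with $|\mathrm{supp}(h)|\equiv k\pmod\sigma$, and for $k\ge0$ let $\mathcal{H}(k,\infty)$ be the set of flows $h$ with $|\mathrm{supp}(h)|=k$. Then $$\sum_{k=0}^{\sigma-1}\omega^k|\mathcal{H}(k,\sigma)| = \omega^{|E|-r}(1-\omega)^rR\!\left(M(G);\frac{q\omega}{1-\omega},\frac{1-\omega}{\omega}\right),$$ $$\sum_{k\ge0}|\mathcal{H}(k,\infty)|X^k = X^{|E|-r}(1-X)^rR\!\left(M(G);\frac{qX}{1-X},\frac{1-X}{X}\right).$$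
   Context: Setting (the paper's hypothesis "$G$ is a totally-$\mathbb{P}$ matrix and $\mathbb{A}$ a $\mathbb{P}$-module of order $q$", read as the following cases): either (i) $G$ is the vertex–edge or cycle–edge matrix of a graph with edge set $E$, or a totally unimodular matrix, and $\mathbb{A}$ is an Abelian group of order $q$; or (ii) $G$ is a matrix over $\mathrm{GF}(p^s)$, $\mathbb{A}=\mathrm{GF}(p^s)^d$, $q=p^{sd}$. With $H$ a matrix orthogonally dual to $G$ (same columns, rows of $H$ orthogonal to rows of $G$, ranks summing to $|E|$; integer in case (i)), a flow of $G$ over $\mathbb{A}$ is $h:E\to\mathbb{A}$ with $Hh^T=0$ (equivalently an $\mathbb{A}$-combination of rows of $G$). $\mathrm{supp}(h)=\{e: h(e)\ne0\}$. $M(G)$ is the matroid on $E$ of linear dependence of the columns of $G$, rank function $\mathrm{rk}$, rank $r$; $R(M;\lambda,x)=\sum_{B\subseteq E}\lambda^{r-\mathrm{rk}(B)}x^{|B|-\mathrm{rk}(B)}$.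
   Formalization: In case (i), H must also satisfy: every integer vector orthogonal to the rows of G has a multiple, by an integer coprime to q, that is an integer combination of rows of H; otherwise the claim fails (G=(0), H=(2), q=2). *)

theory Defs
  imports
    Complex_Main
    "HOL-Library.FuncSet"
    "HOL-Library.Groups_Big_Fun"
    "HOL-Number_Theory.Cong"
    "HOL-Computational_Algebra.Polynomial"
    "HOL-Computational_Algebra.Fraction_Field"
    "HOL-Analysis.Finite_Cartesian_Product"
    "Jordan_Normal_Form.Determinant"
    "Graph_Theory.Digraph"
    "Graph_Theory.Arc_Walk"
begin

text \<open>
  A matrix with row set \<open>V\<close> and column set \<open>E\<close> is a function \<open>G :: 'v \<Rightarrow> 'e \<Rightarrow> 'k\<close>, of which
  only the entries \<open>G v e\<close> with \<open>v \<in> V\<close> and \<open>e \<in> E\<close> matter. Explicit index sets allow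
  empty row sets and column sets.
\<close>

section \<open>The matroid of a matrix\<close>

text \<open>
  The columns are independent as an indexed family: parallel columns are distinct elements of the
  matroid.
\<close>

definition cols_independent :: "'v set \<Rightarrow> ('v \<Rightarrow> 'e \<Rightarrow> 'k::field) \<Rightarrow> 'e set \<Rightarrow> bool" where
  "cols_independent V G I \<longleftrightarrow>
     (\<forall>c. (\<forall>v\<in>V. (\<Sum>e\<in>I. c e * G v e) = 0) \<longrightarrow> (\<forall>e\<in>I. c e = 0))"

definition matroid_rank :: "'v set \<Rightarrow> ('v \<Rightarrow> 'e \<Rightarrow> 'k::field) \<Rightarrow> 'e set \<Rightarrow> nat" where
  "matroid_rank V G B = Max (card ` {I. I \<subseteq> B \<and> cols_independent V G I})"

text \<open>
  For a matroid rank function \<open>rk B \<le> rk E\<close> and \<open>rk B \<le> card B\<close>, so the exponents are not truncated.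
\<close>

definition rank_poly :: "'e set \<Rightarrow> ('e set \<Rightarrow> nat) \<Rightarrow> 'c::comm_ring_1 \<Rightarrow> 'c \<Rightarrow> 'c" where
  "rank_poly E rk l x = (\<Sum>B\<in>Pow E. l ^ (rk E - rk B) * x ^ (card B - rk B))"

definition rat_matrix :: "('v \<Rightarrow> 'e \<Rightarrow> int) \<Rightarrow> 'v \<Rightarrow> 'e \<Rightarrow> rat" where
  "rat_matrix G v e = of_int (G v e)"

section \<open>Totally unimodular matrices and matrices of graphs\<close>

definition totally_unimodular :: "'v set \<Rightarrow> 'e set \<Rightarrow> ('v \<Rightarrow> 'e \<Rightarrow> int) \<Rightarrow> bool" where
  "totally_unimodular V E G \<longleftrightarrow>
     (\<forall>k r c. inj_on r {..<k} \<and> r ` {..<k} \<subseteq> V \<and> inj_on c {..<k} \<and> c ` {..<k} \<subseteq> E \<longrightarrow>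
        Determinant.det (Matrix.mat k k (\<lambda>(i, j). G (r i) (c j))) \<in> {-1, 0, 1})"

text \<open>
  A graph, with loops and multiple edges allowed, is given with an arbitrary reference orientation,
  that is, as a digraph \<open>D\<close> whose arcs are the edges. The matrices below are the signed ones, and
  the column of a loop in the vertex-edge matrix is zero.
\<close>

definition vertex_edge_matrix ::
  "('n, 'e) pre_digraph \<Rightarrow> 'v set \<Rightarrow> ('v \<Rightarrow> 'e \<Rightarrow> int) \<Rightarrow> bool" where
  "vertex_edge_matrix D V G \<longleftrightarrow>
     (\<exists>vert. bij_betw vert V (verts D) \<and>
       (\<forall>v\<in>V. \<forall>e\<in>arcs D.
          G v e = of_bool (head D e = vert v) - of_bool (tail D e = vert v)))"

text \<open>
  The arcs \<open>(e, True)\<close> and \<open>(e, False)\<close> stand for the two directions in which \<open>e\<close> can be traversed.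
\<close>

definition bidirected :: "('n, 'e) pre_digraph \<Rightarrow> ('n, 'e \<times> bool) pre_digraph" where
  "bidirected D =
     \<lparr>verts = verts D,
      arcs = arcs D \<times> UNIV,
      tail = (\<lambda>(e, b). if b then tail D e else head D e),
      head = (\<lambda>(e, b). if b then head D e else tail D e)\<rparr>"

text \<open>
  A directed traversal of a cycle of the underlying undirected graph. Distinctness of the edges
  excludes going back and forth along one edge; loops and pairs of parallel edges are cycles.
\<close>

definition graph_cycle :: "('n, 'e) pre_digraph \<Rightarrow> ('e \<times> bool) list \<Rightarrow> bool" where
  "graph_cycle D c \<longleftrightarrow> pre_digraph.cycle (bidirected D) c \<and> distinct (map fst c)"

text \<open>
  One row for each cycle (identified with its edge set), in an arbitrarily chosen direction of
  traversal.
\<close>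

definition cycle_edge_matrix ::
  "('n, 'e) pre_digraph \<Rightarrow> 'v set \<Rightarrow> ('v \<Rightarrow> 'e \<Rightarrow> int) \<Rightarrow> bool" where
  "cycle_edge_matrix D V G \<longleftrightarrow>
     (\<exists>cyc. (\<forall>v\<in>V. graph_cycle D (cyc v)) \<and>
       bij_betw (\<lambda>v. fst ` set (cyc v)) V {fst ` set c |c. graph_cycle D c} \<and>
       (\<forall>v\<in>V. \<forall>e\<in>arcs D.
          G v e = of_bool ((e, True) \<in> set (cyc v)) - of_bool ((e, False) \<in> set (cyc v))))"

section \<open>Dual matrices and flows\<close>

definition orthogonally_dual ::
  "'e set \<Rightarrow> 'v set \<Rightarrow> ('v \<Rightarrow> 'e \<Rightarrow> 'k::field) \<Rightarrow> 'w set \<Rightarrow> ('w \<Rightarrow> 'e \<Rightarrow> 'k) \<Rightarrow> bool" where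
  "orthogonally_dual E V G W H \<longleftrightarrow>
     (\<forall>v\<in>V. \<forall>w\<in>W. (\<Sum>e\<in>E. G v e * H w e) = 0) \<and>
     matroid_rank V G E + matroid_rank W H E = card E"

text \<open>
  Over the integers, orthogonality and complementary ranks determine the row space of \<open>H\<close> only up to
  finite index, and do not determine the solutions of \<open>H h = 0\<close> in a group with torsion: for the
  \<open>1 \<times> 1\<close> matrices \<open>G = (0)\<close> and \<open>H = (2)\<close> and the group of order \<open>2\<close>, every \<open>h\<close> solves
  \<open>H h = 0\<close>, although the only combination of rows of \<open>G\<close> is \<open>0\<close>. The last condition says that this
  index is prime to the order \<open>q\<close> of the group, so that the solutions are the combinations
  of rows of \<open>G\<close>. If the rows of \<open>H\<close> generate all integer vectors orthogonal to \<open>G\<close>, as in the case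
  of a totally unimodular dual, or of the vertex-edge and cycle-edge matrices of one graph,
  it holds with \<open>m = 1\<close>.
\<close>

definition integrally_dual ::
  "nat \<Rightarrow> 'e set \<Rightarrow> 'v set \<Rightarrow> ('v \<Rightarrow> 'e \<Rightarrow> int) \<Rightarrow> 'w set \<Rightarrow> ('w \<Rightarrow> 'e \<Rightarrow> int) \<Rightarrow> bool" where
  "integrally_dual q E V G W H \<longleftrightarrow>
     orthogonally_dual E V (rat_matrix G) W (rat_matrix H) \<and>
     (\<forall>y. (\<forall>v\<in>V. (\<Sum>e\<in>E. G v e * y e) = 0) \<longrightarrow>
        (\<exists>m c. coprime m (int q) \<and> (\<forall>e\<in>E. m * y e = (\<Sum>w\<in>W. c w * H w e))))"

definition int_scale :: "int \<Rightarrow> 'a::ab_group_add \<Rightarrow> 'a" where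
  "int_scale n a = (if 0 \<le> n then (\<Sum>i<nat n. a) else - (\<Sum>i<nat (- n). a))"

text \<open>
  The parameter \<open>smul\<close> is the action of the entries of \<open>H\<close> on the group. Maps on \<open>E\<close> are
  represented by extensional functions.
\<close>

definition flows ::
  "('k \<Rightarrow> 'a::ab_group_add \<Rightarrow> 'a) \<Rightarrow> 'e set \<Rightarrow> 'w set \<Rightarrow> ('w \<Rightarrow> 'e \<Rightarrow> 'k) \<Rightarrow> ('e \<Rightarrow> 'a) set" where
  "flows smul E W H =
     {h \<in> E \<rightarrow>\<^sub>E UNIV. \<forall>w\<in>W. (\<Sum>e\<in>E. smul (H w e) (h e)) = 0}"

definition supp :: "'e set \<Rightarrow> ('e \<Rightarrow> 'a::zero) \<Rightarrow> 'e set" where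
  "supp E h = {e \<in> E. h e \<noteq> 0}"

definition flows_mod :: "'e set \<Rightarrow> ('e \<Rightarrow> 'a::zero) set \<Rightarrow> nat \<Rightarrow> nat \<Rightarrow> ('e \<Rightarrow> 'a) set" where
  "flows_mod E F k \<sigma> = {h \<in> F. [card (supp E h) = k] (mod \<sigma>)}"

definition flows_inf :: "'e set \<Rightarrow> ('e \<Rightarrow> 'a::zero) set \<Rightarrow> nat \<Rightarrow> ('e \<Rightarrow> 'a) set" where
  "flows_inf E F k = {h \<in> F. card (supp E h) = k}"

section \<open>Roots of unity and the indeterminate\<close>

definition primitive_root_of_unity :: "nat \<Rightarrow> complex \<Rightarrow> bool" where
  "primitive_root_of_unity n w \<longleftrightarrow> w ^ n = 1 \<and> (\<forall>j. 0 < j \<and> j < n \<longrightarrow> w ^ j \<noteq> 1)"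

text \<open>The indeterminate as an element of the field of rational functions.\<close>

definition indet :: "int poly fract" where
  "indet = Fraction_Field.Fract [:0, 1:] 1"

end

theory Submission
  imports Defs
begin

text \<open>
  By the binomial theorem, \<open>X\<close> to the power of the support size of \<open>h\<close> is the sum of
  \<open>X\<close>\<open>^(|E| - |B|) (1 - X)^|B|\<close> over the sets \<open>B\<close> on which \<open>h\<close> vanishes. Hence both identities
  reduce to the fact that exactly \<open>q^(r - rk B)\<close> flows vanish on \<open>B\<close>. For this, extend a maximal
  independent set \<open>C0\<close> of \<open>B\<close> to one, \<open>C1\<close>, of \<open>E\<close>. Every column is a combination of the columns in
  \<open>C1\<close> with coefficients in the ring that acts on the group, and a flow satisfies the same linear
  relations as the columns, so it is determined by its values on \<open>C1\<close>, which are arbitrary; it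
  vanishes on \<open>B\<close> iff it vanishes on \<open>C0\<close>. That the coefficients are integers is Cramer's rule for a
  totally unimodular matrix, to which the vertex-edge matrix of a graph belongs; for cycle matrices
  it follows by rounding a potential.
\<close>

section \<open>Independence and rank of columns\<close>

lemma cols_independent_empty [simp]: "cols_independent V K {}"
  by (simp add: cols_independent_def)

lemma cols_independent_subset:
  assumes "cols_independent V K I" "J \<subseteq> I" "finite I"
  shows "cols_independent V K J"
  unfolding cols_independent_def
proof (intro allI impI ballI)
  fix c e assume c: "\<forall>v\<in>V. (\<Sum>e\<in>J. c e * K v e) = 0" and e: "e \<in> J"
  have "(\<Sum>e\<in>I. (if e \<in> J then c e else 0) * K v e) = (\<Sum>e\<in>J. c e * K v e)" for v
    using assms by (intro sum.mono_neutral_cong_right) auto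
  with c have "(\<Sum>e\<in>I. (if e \<in> J then c e else 0) * K v e) = 0" if "v \<in> V" for v
    using that by simp
  then have "(if e \<in> J then c e else 0) = 0"
    using assms(1)[unfolded cols_independent_def, rule_format, of "\<lambda>e. if e \<in> J then c e else 0" e]
      assms(2) e by auto
  with e show "c e = 0" by simp
qed

text \<open>In a nontrivial relation on \<open>insert e I\<close> the coefficient of
  \<open>e\<close> is nonzero, since otherwise \<open>I\<close> would be dependent; dividing by it
  solves for column \<open>e\<close>.\<close>

lemma dependent_column_combination:
  fixes K :: "'v \<Rightarrow> 'e \<Rightarrow> 'k::field"
  assumes "finite I" "cols_independent V K I" "\<not> cols_independent V K (insert e I)"
  obtains c where "\<And>v. v \<in> V \<Longrightarrow> K v e = (\<Sum>b\<in>I. c b * K v b)"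
proof -
  have e: "e \<notin> I" using assms(2,3) by (auto simp: insert_absorb)
  from assms(3) obtain c b where c: "\<And>v. v \<in> V \<Longrightarrow> (\<Sum>b\<in>insert e I. c b * K v b) = 0"
    and b: "b \<in> insert e I" "c b \<noteq> 0"
    unfolding cols_independent_def by blast
  have c': "c e * K v e + (\<Sum>b\<in>I. c b * K v b) = 0" if "v \<in> V" for v
    using c[OF that] e assms(1) by simp
  have ce: "c e \<noteq> 0"
  proof
    assume "c e = 0"
    with c' have "\<forall>v\<in>V. (\<Sum>b\<in>I. c b * K v b) = 0" by simp
    with assms(2) have "\<forall>b\<in>I. c b = 0" by (simp add: cols_independent_def)
    with b \<open>c e = 0\<close> show False by auto
  qed
  have "K v e = (\<Sum>b\<in>I. - c b / c e * K v b)" if "v \<in> V" for v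
  proof -
    have "(\<Sum>b\<in>I. - c b / c e * K v b) = - (\<Sum>b\<in>I. c b * K v b) / c e"
      by (simp add: sum_divide_distrib sum_negf)
    also have "\<dots> = K v e"
      using ce by (simp add: eq_neg_iff_add_eq_0[THEN iffD2, OF c'[OF that], symmetric])
    finally show ?thesis by simp
  qed
  then show ?thesis using that[of "\<lambda>b. - c b / c e"] by simp
qed

lemma finite_card_independent:
  "finite B \<Longrightarrow> finite (card ` {I. I \<subseteq> B \<and> cols_independent V K I})"
  by simp

lemma matroid_rank_attained:
  assumes "finite B"
  obtains I where "I \<subseteq> B" "cols_independent V K I" "card I = matroid_rank V K B"
proof -
  have "matroid_rank V K B \<in> card ` {I. I \<subseteq> B \<and> cols_independent V K I}"
    unfolding matroid_rank_def
    by (rule Max_in) (use assms finite_card_independent in \<open>auto intro: exI[of _ "{}"]\<close>)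
  then show ?thesis using that by auto
qed

lemma card_le_matroid_rank:
  assumes "finite B" "I \<subseteq> B" "cols_independent V K I"
  shows "card I \<le> matroid_rank V K B"
  unfolding matroid_rank_def
  by (rule Max_ge) (use assms in auto)

lemma matroid_rank_le_card: "finite B \<Longrightarrow> matroid_rank V K B \<le> card B"
  by (metis card_mono matroid_rank_attained)

lemma matroid_rank_mono:
  assumes "finite B'" "B \<subseteq> B'"
  shows "matroid_rank V K B \<le> matroid_rank V K B'"
proof -
  obtain I where "I \<subseteq> B" "cols_independent V K I" "card I = matroid_rank V K B"
    using assms by (meson finite_subset matroid_rank_attained)
  with assms card_le_matroid_rank[of B' I V K] show ?thesis by simp
qed

text \<open>Maximality is meant with respect to inclusion; that it yields the cardinality
  \<open>matroid_rank\<close> is obtained by counting in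
  \<open>card_max_independent\<close>.\<close>

definition max_independent :: "'v set \<Rightarrow> ('v \<Rightarrow> 'e \<Rightarrow> 'k::field) \<Rightarrow> 'e set \<Rightarrow> 'e set \<Rightarrow> bool" where
  "max_independent V K B C \<longleftrightarrow>
     C \<subseteq> B \<and> cols_independent V K C \<and> (\<forall>e\<in>B - C. \<not> cols_independent V K (insert e C))"

lemma max_independent_extend:
  assumes "finite B" "C \<subseteq> B" "cols_independent V K C"
  obtains C' where "C \<subseteq> C'" "max_independent V K B C'"
proof -
  let ?S = "{I. C \<subseteq> I \<and> I \<subseteq> B \<and> cols_independent V K I}"
  have "finite ?S" using assms(1) by simp
  moreover have "C \<in> ?S" using assms by simp
  ultimately obtain M where M: "M \<in> ?S" "\<And>I. I \<in> ?S \<Longrightarrow> M \<subseteq> I \<Longrightarrow> M = I"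
    by (meson finite_has_maximal2)
  have "max_independent V K B M"
    unfolding max_independent_def using M(1) M(2)[of "insert _ M"] by blast
  with M(1) that show ?thesis by blast
qed

lemma max_independent_if_card_eq_rank:
  assumes "finite B" "C \<subseteq> B" "cols_independent V K C" "card C = matroid_rank V K B"
  shows "max_independent V K B C"
  unfolding max_independent_def
proof (intro conjI ballI notI assms)
  fix e assume e: "e \<in> B - C" "cols_independent V K (insert e C)"
  then have "card (insert e C) \<le> card C"
    using card_le_matroid_rank[of B "insert e C" V K] assms by auto
  with e assms show False by (simp add: finite_subset)
qed

section \<open>Counting the row maps that vanish on a set of columns\<close>

text \<open>
  The maps that are annihilated by every linear relation between the columns of \<open>G\<close>; for a field,
  these are the combinations of the rows of \<open>G\<close>.
\<close>

definition row_maps ::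
  "('k::comm_ring_1 \<Rightarrow> 'a::ab_group_add \<Rightarrow> 'a) \<Rightarrow> 'e set \<Rightarrow> 'v set \<Rightarrow> ('v \<Rightarrow> 'e \<Rightarrow> 'k) \<Rightarrow>
     ('e \<Rightarrow> 'a) set" where
  "row_maps smul E V G =
     {h \<in> E \<rightarrow>\<^sub>E UNIV. \<forall>y. (\<forall>v\<in>V. (\<Sum>e\<in>E. G v e * y e) = 0) \<longrightarrow> (\<Sum>e\<in>E. smul (y e) (h e)) = 0}"

text \<open>The entries of \<open>G\<close> lie in the ring that acts on the group, whereas
  independence is tested on \<open>K\<close> over a field: \<open>K\<close> is
  \<open>rat_matrix G\<close> for integer matrices and \<open>G\<close> itself over a field. The two
  assumptions on \<open>K\<close> carry linear algebra over the field back to coefficients in the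
  ring.\<close>

locale module_matrix = Modules.module smul
  for smul :: "'k::comm_ring_1 \<Rightarrow> 'a::ab_group_add \<Rightarrow> 'a" +
  fixes E :: "'e set" and V :: "'v set" and G :: "'v \<Rightarrow> 'e \<Rightarrow> 'k" and K :: "'v \<Rightarrow> 'e \<Rightarrow> 'f::field"
  assumes finite_cols: "finite E"
    and independent_zero: "\<And>I c b. I \<subseteq> E \<Longrightarrow> cols_independent V K I \<Longrightarrow>
          (\<And>v. v \<in> V \<Longrightarrow> (\<Sum>b\<in>I. c b * G v b) = 0) \<Longrightarrow> b \<in> I \<Longrightarrow> c b = 0"
    and dependent_combination: "\<And>I e. I \<subseteq> E \<Longrightarrow> cols_independent V K I \<Longrightarrow> e \<in> E \<Longrightarrow>
          \<not> cols_independent V K (insert e I) \<Longrightarrow> \<exists>c. \<forall>v\<in>V. G v e = (\<Sum>b\<in>I. c b * G v b)"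
begin

text \<open>This makes results on the full column set, in particular
  \<open>card_max_independent\<close>, available for \<open>B\<close>.\<close>

lemma module_matrix_subset: "B \<subseteq> E \<Longrightarrow> module_matrix smul B V G K"
proof unfold_locales
  assume B: "B \<subseteq> E"
  show "finite B" using B finite_cols by (rule finite_subset)
  show "c b = 0" if "I \<subseteq> B" "cols_independent V K I"
    "\<And>v. v \<in> V \<Longrightarrow> (\<Sum>b\<in>I. c b * G v b) = 0" "b \<in> I" for I c b
    using that B independent_zero by blast
  show "\<exists>c. \<forall>v\<in>V. G v e = (\<Sum>b\<in>I. c b * G v b)" if "I \<subseteq> B" "cols_independent V K I"
    "e \<in> B" "\<not> cols_independent V K (insert e I)" for I e
    using that B dependent_combination by blast
qed

text \<open>The vector \<open>?y\<close> with entry 1 at \<open>e\<close>, \<open>- c b\<close> on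
  \<open>I\<close> and 0 elsewhere is a relation between the columns, so it annihilates
  \<open>h\<close>.\<close>

lemma row_maps_relation:
  assumes h: "h \<in> row_maps smul E V G" and I: "I \<subseteq> E" "e \<in> E" "e \<notin> I"
    and c: "\<And>v. v \<in> V \<Longrightarrow> G v e = (\<Sum>b\<in>I. c b * G v b)"
  shows "h e = (\<Sum>b\<in>I. smul (c b) (h b))"
proof -
  let ?y = "\<lambda>b. if b = e then 1 else if b \<in> I then - c b else 0"
  have E: "E = insert e (E - {e})" using I by auto
  have I': "finite I" using I finite_cols finite_subset by blast
  have split: "(\<Sum>b\<in>E. if b = e then f b else if b \<in> I then g b else 0) = f e + (\<Sum>b\<in>I. g b)"
    for f g :: "'e \<Rightarrow> 'z::ab_group_add"
  proof -
    have "(\<Sum>b\<in>E. if b = e then f b else if b \<in> I then g b else 0)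
        = (\<Sum>b\<in>insert e I. if b = e then f b else if b \<in> I then g b else 0)"
      using I finite_cols by (intro sum.mono_neutral_right) auto
    also have "\<dots> = f e + (\<Sum>b\<in>I. g b)"
      using I I' by (auto intro!: sum.cong)
    finally show ?thesis .
  qed
  have "(\<Sum>b\<in>E. G v b * ?y b) = 0" if "v \<in> V" for v
  proof -
    have "(\<Sum>b\<in>E. G v b * ?y b)
        = (\<Sum>b\<in>E. if b = e then G v b else if b \<in> I then - (c b * G v b) else 0)"
      by (intro sum.cong) auto
    also have "\<dots> = 0"
      by (simp only: split) (simp add: c[OF that] sum_negf)
    finally show ?thesis .
  qed
  with h have "(\<Sum>b\<in>E. smul (?y b) (h b)) = 0" by (auto simp: row_maps_def)
  moreover have "(\<Sum>b\<in>E. smul (?y b) (h b))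
      = (\<Sum>b\<in>E. if b = e then h b else if b \<in> I then - smul (c b) (h b) else 0)"
    by (intro sum.cong) auto
  ultimately have "h e + (\<Sum>b\<in>I. - smul (c b) (h b)) = 0"
    by (simp only: split)
  then show ?thesis by (simp add: sum_negf)
qed

text \<open>Restriction to \<open>C1 - C0\<close> is a bijection onto all maps from that set to the
  group: the values on \<open>C0\<close> are forced to be zero, the others are free, and together
  they determine the map.\<close>

lemma card_row_maps_vanishing:
  assumes B: "B \<subseteq> E" "max_independent V K B C0" "max_independent V K E C1" "C0 \<subseteq> C1"
  shows "card {h \<in> row_maps smul E V G. \<forall>e\<in>B. h e = 0} = CARD('a) ^ (card C1 - card C0)"
proof -
  let ?T = "{h \<in> row_maps smul E V G. \<forall>e\<in>B. h e = 0}"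
  let ?D = "C1 - C0"
  have C1: "C1 \<subseteq> E" "cols_independent V K C1" and C0: "C0 \<subseteq> B" "cols_independent V K C0"
    using B by (auto simp: max_independent_def)
  have fin: "finite C1" "finite C0" "finite ?D"
    using C1 B finite_cols by (auto intro: finite_subset)
  have "\<exists>c. \<forall>v\<in>V. G v e = (\<Sum>b\<in>C1. c b * G v b)" if "e \<in> E" for e
  proof (cases "e \<in> C1")
    case True
    then have "\<forall>v\<in>V. G v e = (\<Sum>b\<in>C1. of_bool (b = e) * G v b)"
      using fin by (simp add: of_bool_def if_distrib if_distribR sum.delta cong: if_cong)
    then show ?thesis by (intro exI)
  next
    case False
    with dependent_combination C1 that B(3) show ?thesis
      by (auto simp: max_independent_def)
  qed
  then obtain N0 where N0: "\<And>e v. e \<in> E \<Longrightarrow> v \<in> V \<Longrightarrow> G v e = (\<Sum>b\<in>C1. N0 e b * G v b)"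
    by metis
  \<comment> \<open>On \<open>C1\<close> the coefficients are set to unit vectors, so that the
    extension \<open>h\<close> below visibly takes the prescribed values on
    \<open>C1\<close>.\<close>
  define N where "N e b = (if e \<in> C1 then of_bool (b = e) else N0 e b)" for e b
  have N: "G v e = (\<Sum>b\<in>C1. N e b * G v b)" if "e \<in> E" "v \<in> V" for e v
  proof (cases "e \<in> C1")
    case True
    have "(\<Sum>b\<in>C1. N e b * G v b) = (\<Sum>b\<in>C1. if b = e then G v b else 0)"
      using True by (intro sum.cong) (auto simp: N_def)
    with True fin show ?thesis by simp
  qed (use N0[OF that] in \<open>simp add: N_def\<close>)
  have rel: "h e = (\<Sum>b\<in>C1. smul (N e b) (h b))" if "h \<in> row_maps smul E V G" "e \<in> E" for h e
  proof (cases "e \<in> C1")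
    case True
    have "(\<Sum>b\<in>C1. smul (N e b) (h b)) = (\<Sum>b\<in>C1. if b = e then h b else 0)"
      using True by (intro sum.cong) (auto simp: N_def)
    with True fin show ?thesis by simp
  qed (use row_maps_relation[OF that(1)] C1 that N in auto)
  have "bij_betw (\<lambda>h. restrict h ?D) ?T (?D \<rightarrow>\<^sub>E UNIV)"
  proof (rule bij_betwI')
    fix h h' assume h: "h \<in> ?T" "h' \<in> ?T"
    show "restrict h ?D = restrict h' ?D \<longleftrightarrow> h = h'"
    proof
      assume eq: "restrict h ?D = restrict h' ?D"
      have "h b = h' b" if "b \<in> C1" for b
        using that h C0 fun_cong[OF eq, of b] by (cases "b \<in> C0") auto
      then have "h e = h' e" if "e \<in> E" for e
        using rel[of h e] rel[of h' e] h that by simp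
      moreover have "h \<in> E \<rightarrow>\<^sub>E UNIV" "h' \<in> E \<rightarrow>\<^sub>E UNIV"
        using h by (auto simp: row_maps_def)
      ultimately show "h = h'" by (intro PiE_ext) auto
    qed simp
  next
    fix f assume f: "f \<in> ?D \<rightarrow>\<^sub>E (UNIV :: 'a set)"
    \<comment> \<open>For surjectivity, \<open>f\<close> is continued by zero on \<open>C0\<close>
      and then extended from \<open>C1\<close> to \<open>E\<close> by the coefficients
      \<open>N\<close>.\<close>
    define g where "g b = (if b \<in> ?D then f b else 0)" for b
    define h where "h = (\<lambda>e\<in>E. \<Sum>b\<in>C1. smul (N e b) (g b))"
    have "(\<Sum>e\<in>E. smul (y e) (h e)) = 0"
      if y: "\<And>v. v \<in> V \<Longrightarrow> (\<Sum>e\<in>E. G v e * y e) = 0" for y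
    proof -
      \<comment> \<open>Expanding every column in terms of \<open>C1\<close> turns the relation
        \<open>y\<close> into a relation between independent columns, whose coefficients must
        vanish.\<close>
      have 0: "(\<Sum>e\<in>E. y e * N e b) = 0" if "b \<in> C1" for b
      proof (rule independent_zero[OF C1 _ that])
        fix v assume v: "v \<in> V"
        have "(\<Sum>b\<in>C1. (\<Sum>e\<in>E. y e * N e b) * G v b) = (\<Sum>b\<in>C1. \<Sum>e\<in>E. y e * (N e b * G v b))"
          by (simp add: sum_distrib_right mult.assoc)
        also have "\<dots> = (\<Sum>e\<in>E. \<Sum>b\<in>C1. y e * (N e b * G v b))"
          by (rule sum.swap)
        also have "\<dots> = (\<Sum>e\<in>E. G v e * y e)"
          using N v by (simp add: sum_distrib_left[symmetric] mult.commute)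
        finally show "(\<Sum>b\<in>C1. (\<Sum>e\<in>E. y e * N e b) * G v b) = 0"
          using y[OF v] by simp
      qed
      have "(\<Sum>e\<in>E. smul (y e) (h e)) = (\<Sum>e\<in>E. \<Sum>b\<in>C1. smul (y e * N e b) (g b))"
        by (simp add: h_def scale_sum_right)
      also have "\<dots> = (\<Sum>b\<in>C1. \<Sum>e\<in>E. smul (y e * N e b) (g b))"
        by (rule sum.swap)
      also have "\<dots> = (\<Sum>b\<in>C1. smul (\<Sum>e\<in>E. y e * N e b) (g b))"
        by (simp add: scale_sum_left)
      also have "\<dots> = 0" using 0 by simp
      finally show ?thesis .
    qed
    then have hT: "h \<in> row_maps smul E V G"
      by (auto simp: row_maps_def h_def)
    have hg: "h b = g b" if "b \<in> C1" for b
    proof -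
      have "h b = (\<Sum>b'\<in>C1. if b' = b then g b' else 0)"
        using that C1 by (auto simp: h_def N_def intro!: sum.cong)
      with that fin show ?thesis by simp
    qed
    have "h e = 0" if e: "e \<in> B" for e
    proof (cases "e \<in> C0")
      case True
      then show ?thesis using hg[of e] B by (auto simp: g_def)
    next
      case False
      obtain c where "\<And>v. v \<in> V \<Longrightarrow> G v e = (\<Sum>b\<in>C0. c b * G v b)"
        using dependent_combination[of C0 e] False e B C0 unfolding max_independent_def by blast
      from row_maps_relation[OF hT _ _ False this] have "h e = (\<Sum>b\<in>C0. smul (c b) (h b))"
        using C0 B e by auto
      also have "\<dots> = 0"
        using hg B by (intro sum.neutral) (auto simp: g_def subset_iff)
      finally show ?thesis .
    qed
    with hT have "h \<in> ?T" by simp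
    moreover have "f = restrict h ?D"
      using f hg by (intro PiE_ext[OF f]) (auto simp: g_def)
    ultimately show "\<exists>h\<in>?T. f = restrict h ?D" by blast
  qed auto
  then have "card ?T = card (?D \<rightarrow>\<^sub>E (UNIV :: 'a set))"
    by (rule bij_betw_same_card)
  also have "\<dots> = CARD('a) ^ card ?D"
    using fin by (simp add: card_PiE)
  also have "card ?D = card C1 - card C0"
    using fin B by (simp add: card_Diff_subset)
  finally show ?thesis .
qed

text \<open>Each maximal independent set determines the number of row maps; this replaces the exchange
  property of the matroid.\<close>

lemma card_max_independent:
  assumes C: "max_independent V K E C" and q: "CARD('a) > 1"
  shows "card C = matroid_rank V K E"
proof -
  obtain I where I: "I \<subseteq> E" "cols_independent V K I" "card I = matroid_rank V K E"
    using finite_cols by (rule matroid_rank_attained)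
  then have I': "max_independent V K E I"
    by (intro max_independent_if_card_eq_rank finite_cols)
  have 0: "max_independent V K {} {}"
    by (simp add: max_independent_def)
  have "CARD('a) ^ card C = CARD('a) ^ card I"
    using card_row_maps_vanishing[OF _ 0 C] card_row_maps_vanishing[OF _ 0 I'] by simp
  with q have "card C = card I" using power_inject_exp by blast
  with I show ?thesis by simp
qed

theorem card_row_maps_rank:
  assumes B: "B \<subseteq> E" and fin: "finite (UNIV :: 'a set)"
  shows "card {h \<in> row_maps smul E V G. \<forall>e\<in>B. h e = 0}
    = CARD('a) ^ (matroid_rank V K E - matroid_rank V K B)"
proof -
  obtain C0 where C0: "max_independent V K B C0"
    using max_independent_extend[of B "{}" V K] B finite_cols by (auto intro: finite_subset)
  then obtain C1 where C1: "C0 \<subseteq> C1" "max_independent V K E C1"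
    using max_independent_extend[of E C0 V K] B finite_cols by (auto simp: max_independent_def)
  have *: "card {h \<in> row_maps smul E V G. \<forall>e\<in>B. h e = 0} = CARD('a) ^ (card C1 - card C0)"
    using card_row_maps_vanishing[OF B C0 C1(2,1)] .
  show ?thesis
  \<comment> \<open>For the trivial group, powers of 1 do not reveal the cardinality of a maximal
    independent set, but then both sides equal 1.\<close>
  proof (cases "CARD('a) > 1")
    case True
    then show ?thesis
      using * card_max_independent[OF C1(2)] module_matrix.card_max_independent[OF module_matrix_subset[OF B] C0]
      by simp
  next
    case False
    then have "CARD('a) = 1" using fin by (metis card_gt_0_iff UNIV_not_empty nat_neq_iff less_one)
    then show ?thesis using * by simp
  qed
qed

end

section \<open>Comparing flows with row maps\<close>

text \<open>Each row of \<open>H\<close> is itself a relation between the columns of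
  \<open>G\<close>.\<close>

lemma row_maps_subset_flows:
  assumes "\<And>v w. v \<in> V \<Longrightarrow> w \<in> W \<Longrightarrow> (\<Sum>e\<in>E. G v e * H w e) = 0"
  shows "row_maps smul E V G \<subseteq> flows smul E W H"
  using assms by (auto simp: row_maps_def flows_def)

text \<open>A flow is determined by its values off a maximum independent set \<open>C\<close> of
  columns of \<open>H\<close>: if two flows agree there, each coordinate of their difference is a
  relation between the columns in \<open>C\<close>. The bound later forces equality in the inclusion
  of the row maps.\<close>

lemma card_flows_le:
  fixes H :: "'w \<Rightarrow> 'e \<Rightarrow> 'f::field"
  assumes E: "finite E" and fin: "finite (UNIV :: ('f ^ 'd::finite) set)"
  shows "card (flows (*s) E W H :: ('e \<Rightarrow> 'f ^ 'd) set) \<le> CARD('f ^ 'd) ^ (card E - matroid_rank W H E)"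
proof -
  let ?F = "flows (*s) E W H :: ('e \<Rightarrow> 'f ^ 'd) set"
  obtain C where C: "C \<subseteq> E" "cols_independent W H C" "card C = matroid_rank W H E"
    using E by (rule matroid_rank_attained)
  have finC: "finite C" using C E finite_subset by blast
  have "inj_on (\<lambda>h. restrict h (E - C)) ?F"
  proof (rule inj_onI)
    fix h h' :: "'e \<Rightarrow> 'f ^ 'd"
    assume h: "h \<in> ?F" "h' \<in> ?F" and eq: "restrict h (E - C) = restrict h' (E - C)"
    have off: "h e = h' e" if "e \<in> E - C" for e
      using fun_cong[OF eq, of e] that by simp
    have on: "h b = h' b" if b: "b \<in> C" for b
    proof (rule Finite_Cartesian_Product.vec_eq_iff[THEN iffD2], rule allI)
      fix i
      have "(\<Sum>b\<in>C. (vec_nth (h b) i - vec_nth (h' b) i) * H w b) = 0" if w: "w \<in> W" for w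
      proof -
        have "(\<Sum>b\<in>C. (vec_nth (h b) i - vec_nth (h' b) i) * H w b)
            = (\<Sum>b\<in>E. (vec_nth (h b) i - vec_nth (h' b) i) * H w b)"
          using C E off by (intro sum.mono_neutral_left) auto
        also have "\<dots> = vec_nth (\<Sum>b\<in>E. H w b *s h b) i - vec_nth (\<Sum>b\<in>E. H w b *s h' b) i"
          by (simp add: sum_subtractf algebra_simps)
        also have "\<dots> = 0" using h w by (simp add: flows_def)
        finally show ?thesis .
      qed
      with C(2)[unfolded cols_independent_def, rule_format,
          of "\<lambda>b. vec_nth (h b) i - vec_nth (h' b) i" b] b
      show "vec_nth (h b) i = vec_nth (h' b) i" by simp
    qed
    show "h = h'"
      using h on off by (intro PiE_ext[of h E "\<lambda>_. UNIV"]) (auto simp: flows_def)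
  qed
  moreover have "(\<lambda>h. restrict h (E - C)) ` ?F \<subseteq> E - C \<rightarrow>\<^sub>E UNIV"
    by (intro image_subsetI restrict_PiE_iff[THEN iffD2]) simp
  ultimately have "card ?F \<le> card (E - C \<rightarrow>\<^sub>E (UNIV :: ('f ^ 'd) set))"
    using E fin by (intro card_inj_on_le) (auto intro: finite_PiE)
  also have "\<dots> = CARD('f ^ 'd) ^ (card E - matroid_rank W H E)"
    using E finC C by (simp add: card_PiE card_Diff_subset)
  finally show ?thesis .
qed

section \<open>The rank generating function\<close>

text \<open>Double counting of the pairs \<open>(B, h)\<close> with \<open>h\<close> vanishing on
  \<open>B\<close>: summing over \<open>h\<close> first gives the rank polynomial, summing over
  \<open>B\<close> first gives the support enumerator.\<close>

lemma support_enumerator: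
  fixes X :: "'c::field" and F :: "('e \<Rightarrow> 'a::zero) set"
  assumes E: "finite E" and F: "finite F" and X: "X \<noteq> 0" "X \<noteq> 1"
    and rk: "\<And>B. B \<subseteq> E \<Longrightarrow> rk B \<le> rk E" "\<And>B. B \<subseteq> E \<Longrightarrow> rk B \<le> card B"
    and cnt: "\<And>B. B \<subseteq> E \<Longrightarrow> card {h \<in> F. \<forall>e\<in>B. h e = 0} = q ^ (rk E - rk B)"
  shows "(\<Sum>h\<in>F. X ^ card (supp E h)) = X ^ (card E - rk E) * (1 - X) ^ rk E *
     rank_poly E rk (of_nat q * X / (1 - X)) ((1 - X) / X)"
proof -
  have summand: "X ^ (card E - rk E) * (1 - X) ^ rk E * ((of_nat q * X / (1 - X)) ^ (rk E - rk B) *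
      ((1 - X) / X) ^ (card B - rk B))
     = (\<Sum>h\<in>{h \<in> F. \<forall>e\<in>B. h e = 0}. X ^ (card E - card B) * (1 - X) ^ card B)"
    if B: "B \<subseteq> E" for B
  proof -
    have le: "rk B \<le> rk E" "rk B \<le> card B" "card B \<le> card E" "rk E \<le> card E"
      using rk[OF B] rk[of E] B E by (auto intro: card_mono)
    define Y where "Y = 1 - X"
    have Y: "Y \<noteq> 0" using X by (simp add: Y_def)
    \<comment> \<open>The four differences of exponents are named to remove truncated
      subtraction.\<close>
    obtain i where i: "rk E = rk B + i" using le nat_le_iff_add by blast
    obtain j where j: "card B = rk B + j" using le nat_le_iff_add by blast
    obtain k where k: "card E = rk E + k" using le nat_le_iff_add by blast
    obtain l where l: "card E = card B + l" using le nat_le_iff_add by blast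
    have kl: "k + i = l + j" using i j k l by simp
    \<comment> \<open>The exponent of \<open>X\<close> should be \<open>l = k + i - j\<close>;
      multiplying by \<open>X ^ j\<close> avoids this subtraction and is undone below.\<close>
    have "X ^ k * Y ^ (rk B + i) * ((of_nat q * X / Y) ^ i * (Y / X) ^ j) * X ^ j
        = of_nat q ^ i * X ^ (k + i) * Y ^ (rk B + j)"
      using X Y by (simp add: field_simps power_add power_mult_distrib power_divide)
    also have "\<dots> = of_nat q ^ i * X ^ l * Y ^ (rk B + j) * X ^ j"
      by (simp add: kl power_add)
    finally have "X ^ k * Y ^ (rk B + i) * ((of_nat q * X / Y) ^ i * (Y / X) ^ j)
        = of_nat q ^ i * X ^ l * Y ^ (rk B + j)"
      using X by simp
    moreover have "rk E - rk B = i" "card B - rk B = j" "card E - rk E = k" "card E - card B = l"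
      using i j k l by auto
    ultimately show ?thesis
      using cnt[OF B] i j by (simp add: Y_def[symmetric])
  qed
  have enum: "(\<Sum>B\<in>{B\<in>Pow E. \<forall>e\<in>B. h e = 0}. X ^ (card E - card B) * (1 - X) ^ card B)
      = X ^ card (supp E h)" for h :: "'e \<Rightarrow> 'a"
  proof -
    let ?Z = "E - supp E h"
    have Z: "finite ?Z" and sE: "supp E h \<subseteq> E" using E by (auto simp: supp_def)
    have cE: "card E = card (supp E h) + card ?Z"
      using E sE by (metis card_mono card_Diff_subset finite_subset le_add_diff_inverse)
    have "{B\<in>Pow E. \<forall>e\<in>B. h e = 0} = Pow ?Z" by (auto simp: supp_def)
    then have "(\<Sum>B\<in>{B\<in>Pow E. \<forall>e\<in>B. h e = 0}. X ^ (card E - card B) * (1 - X) ^ card B)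
        = (\<Sum>B\<in>Pow ?Z. X ^ card (supp E h) * (X ^ (card ?Z - card B) * (1 - X) ^ card B))"
      using cE Z by (auto intro!: sum.cong simp: card_mono power_add[symmetric])
    also have "\<dots> = X ^ card (supp E h) * (\<Sum>B\<in>Pow ?Z. (\<Prod>_\<in>B. 1 - X) * (\<Prod>_\<in>?Z - B. X))"
      using Z by (auto simp: sum_distrib_left card_Diff_subset finite_subset intro!: sum.cong)
    also have "\<dots> = X ^ card (supp E h) * (\<Prod>_\<in>?Z. (1 - X) + X)"
      \<comment> \<open>The sum over subsets of \<open>?Z\<close> is the expansion of a product
        whose factors \<open>(1 - X) + X\<close> all equal 1.\<close>
      using Z by (subst prod_add) simp_all
    finally show ?thesis by simp
  qed
  have "X ^ (card E - rk E) * (1 - X) ^ rk E *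
     rank_poly E rk (of_nat q * X / (1 - X)) ((1 - X) / X)
     = (\<Sum>B\<in>Pow E. \<Sum>h\<in>{h \<in> F. \<forall>e\<in>B. h e = 0}. X ^ (card E - card B) * (1 - X) ^ card B)"
    unfolding rank_poly_def sum_distrib_left using summand by (intro sum.cong) auto
  also have "\<dots> = (\<Sum>h\<in>F. \<Sum>B\<in>{B\<in>Pow E. \<forall>e\<in>B. h e = 0}. X ^ (card E - card B) * (1 - X) ^ card B)"
    using E F by (intro sum.swap_restrict) auto
  finally show ?thesis using enum by simp
qed

section \<open>Sorting flows by the size of the support\<close>

text \<open>Powers of \<open>\<omega>\<close> depend on the exponent modulo \<open>\<sigma>\<close>
  alone, so each residue class of support sizes contributes one common power.\<close>

lemma sum_flows_mod:
  fixes \<omega> :: "'c::comm_ring_1"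
  assumes "finite F" "\<omega> ^ \<sigma> = 1" "0 < \<sigma>"
  shows "(\<Sum>k = 0..\<sigma> - 1. \<omega> ^ k * of_nat (card (flows_mod E F k \<sigma>))) = (\<Sum>h\<in>F. \<omega> ^ card (supp E h))"
proof -
  have pow: "\<omega> ^ n = \<omega> ^ (n mod \<sigma>)" for n
  proof -
    have "\<omega> ^ n = \<omega> ^ (\<sigma> * (n div \<sigma>) + n mod \<sigma>)" by simp
    also have "\<dots> = \<omega> ^ (n mod \<sigma>)" by (simp only: power_add power_mult assms(2)) simp
    finally show ?thesis .
  qed
  have "(\<Sum>h\<in>F. \<omega> ^ card (supp E h))
      = (\<Sum>k = 0..\<sigma> - 1. \<Sum>h\<in>{h \<in> F. card (supp E h) mod \<sigma> = k}. \<omega> ^ card (supp E h))"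
  proof (intro sum.group[symmetric] assms finite_atLeastAtMost subsetI)
    fix k assume "k \<in> (\<lambda>h. card (supp E h) mod \<sigma>) ` F"
    then have "k < \<sigma>" using assms(3) by auto
    then show "k \<in> {0..\<sigma> - 1}" by simp
  qed
  also have "\<dots> = (\<Sum>k = 0..\<sigma> - 1. \<omega> ^ k * of_nat (card (flows_mod E F k \<sigma>)))"
  proof (intro sum.cong refl)
    fix k assume "k \<in> {0..\<sigma> - 1}"
    then have "k mod \<sigma> = k" using assms by auto
    then have "{h \<in> F. card (supp E h) mod \<sigma> = k} = flows_mod E F k \<sigma>"
      by (auto simp: flows_mod_def cong_def)
    moreover have "\<omega> ^ card (supp E h) = \<omega> ^ k" if "h \<in> flows_mod E F k \<sigma>" for h
      using that pow by (metis (no_types, lifting) cong_def flows_mod_def mem_Collect_eq)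
    ultimately show "(\<Sum>h\<in>{h \<in> F. card (supp E h) mod \<sigma> = k}. \<omega> ^ card (supp E h))
        = \<omega> ^ k * of_nat (card (flows_mod E F k \<sigma>))"
      by (simp add: mult.commute)
  qed
  finally show ?thesis by simp
qed

text \<open>No support exceeds \<open>card E\<close>, so only finitely many terms are nonzero and
  \<open>Sum_any\<close> is an ordinary sum.\<close>

lemma Sum_any_flows_inf:
  fixes X :: "'c::comm_ring_1"
  assumes "finite E" "finite F"
  shows "Sum_any (\<lambda>k. of_nat (card (flows_inf E F k)) * X ^ k) = (\<Sum>h\<in>F. X ^ card (supp E h))"
proof -
  have le: "card (supp E h) \<le> card E" for h :: "'a \<Rightarrow> 'b"
    using assms(1) by (intro card_mono) (auto simp: supp_def)
  have "{k. of_nat (card (flows_inf E F k)) * X ^ k \<noteq> 0} \<subseteq> {..card E}"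
  proof
    fix k assume "k \<in> {k. of_nat (card (flows_inf E F k)) * X ^ k \<noteq> 0}"
    then have "card (flows_inf E F k) \<noteq> 0" by (intro notI) simp
    then have "flows_inf E F k \<noteq> {}" by auto
    then show "k \<in> {..card E}" using le by (auto simp: flows_inf_def)
  qed
  then have "Sum_any (\<lambda>k. of_nat (card (flows_inf E F k)) * X ^ k)
      = (\<Sum>k\<le>card E. of_nat (card (flows_inf E F k)) * X ^ k)"
    by (intro Sum_any.expand_superset) auto
  also have "\<dots> = (\<Sum>k\<le>card E. \<Sum>h\<in>{h \<in> F. card (supp E h) = k}. X ^ card (supp E h))"
    by (simp add: flows_inf_def)
  also have "\<dots> = (\<Sum>h\<in>F. X ^ card (supp E h))"
    using assms le by (intro sum.group) auto
  finally show ?thesis .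
qed

section \<open>Totally unimodular matrices\<close>

abbreviation submat :: "('v \<Rightarrow> 'e \<Rightarrow> 'k) \<Rightarrow> nat \<Rightarrow> (nat \<Rightarrow> 'v) \<Rightarrow> (nat \<Rightarrow> 'e) \<Rightarrow> 'k mat" where
  "submat G k r c \<equiv> Matrix.mat k k (\<lambda>(i, j). G (r i) (c j))"

text \<open>The map \<open>insert_index i\<close> skips \<open>i\<close>, so deleting a row and a
  column again yields a matrix of the form \<open>submat\<close>. This keeps Laplace expansion
  inside the induction.\<close>

lemma mat_delete_submat:
  "mat_delete (submat G (Suc k) r c) i j =
     submat G k (\<lambda>i'. r (insert_index i i')) (\<lambda>j'. c (insert_index j j'))"
  by (rule eq_matI) (auto simp: mat_delete_def insert_index_def)

text \<open>The minor is built row by row: the cofactors along the last row of the next minor are a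
  nonzero vector of coefficients, so some row of \<open>G\<close> is not orthogonal to them.\<close>

lemma independent_cols_minor:
  fixes G :: "'v \<Rightarrow> 'e \<Rightarrow> int"
  assumes "inj_on c {..<k}" "cols_independent V (rat_matrix G) (c ` {..<k})"
  obtains r where "inj_on r {..<k}" "r ` {..<k} \<subseteq> V" "Determinant.det (submat G k r c) \<noteq> 0"
  using assms
proof (induction k arbitrary: thesis)
  case 0
  then show ?case by simp
next
  case (Suc k)
  have "inj_on c {..<k}"
    using Suc.prems(2) by (rule inj_on_subset) auto
  moreover have "cols_independent V (rat_matrix G) (c ` {..<k})"
    using Suc.prems(3) by (rule cols_independent_subset) auto
  ultimately obtain r where r: "inj_on r {..<k}" "r ` {..<k} \<subseteq> V"
    "Determinant.det (submat G k r c) \<noteq> 0"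
    using Suc.IH by blast
  define cof where "cof j = cofactor (submat G (Suc k) r c) k j" for j
  \<comment> \<open>Cofactors along row \<open>k\<close> do not involve that row; they are therefore
    fixed before the new row \<open>v\<close> is chosen, and the last one is the previous
    minor.\<close>
  have cof: "cofactor (submat G (Suc k) (r(k := v)) c) k j = cof j" if "j < Suc k" for v j
    unfolding cof_def cofactor_def mat_delete_submat
    by (intro arg_cong2[of _ _ _ _ "(*)"] refl arg_cong[of _ _ Determinant.det] eq_matI)
      (auto simp: insert_index_def)
  have "cof k = Determinant.det (submat G k r c)"
    unfolding cof_def cofactor_def mat_delete_submat
    by (auto simp: insert_index_def intro!: arg_cong[of _ _ Determinant.det] eq_matI)
  with r have cof_k: "cof k \<noteq> 0" by simp
  define c' where "c' = the_inv_into {..<Suc k} c"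
  have c': "c' (c j) = j" if "j < Suc k" for j
    unfolding c'_def using that Suc.prems(2) by (intro the_inv_into_f_f) auto
  have "\<not> (\<forall>v\<in>V. (\<Sum>b\<in>c ` {..<Suc k}. of_int (cof (c' b)) * rat_matrix G v b) = 0)"
  proof
    assume "\<forall>v\<in>V. (\<Sum>b\<in>c ` {..<Suc k}. of_int (cof (c' b)) * rat_matrix G v b) = 0"
    with Suc.prems(3)[unfolded cols_independent_def, rule_format,
        of "\<lambda>b. of_int (cof (c' b))" "c k"]
    have "of_int (cof (c' (c k))) = (0 :: rat)" by blast
    with cof_k c' show False by simp
  qed
  then obtain v where v: "v \<in> V"
    "(\<Sum>b\<in>c ` {..<Suc k}. of_int (cof (c' b)) * rat_matrix G v b) \<noteq> 0" by blast
  have "(\<Sum>b\<in>c ` {..<Suc k}. of_int (cof (c' b)) * rat_matrix G v b)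
      = (\<Sum>j<Suc k. of_int (cof (c' (c j))) * rat_matrix G v (c j))"
    using Suc.prems(2) by (rule sum.reindex_cong) auto
  also have "\<dots> = (\<Sum>j<Suc k. of_int (G v (c j) * cof j))"
    using c' by (intro sum.cong) (auto simp: rat_matrix_def)
  also have "\<dots> = of_int (\<Sum>j<Suc k. G v (c j) * cof j)"
    by simp
  finally have nz: "(\<Sum>j<Suc k. G v (c j) * cof j) \<noteq> 0"
    using v by (metis of_int_0)
  let ?r = "r(k := v)"
  have "Determinant.det (submat G (Suc k) ?r c)
      = (\<Sum>j<Suc k. submat G (Suc k) ?r c $$ (k, j) * cofactor (submat G (Suc k) ?r c) k j)"
    by (rule laplace_expansion_row) auto
  also have "\<dots> = (\<Sum>j<Suc k. G v (c j) * cof j)"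
    using cof by (intro sum.cong) auto
  finally have det: "Determinant.det (submat G (Suc k) ?r c) \<noteq> 0"
    using nz by simp
  \<comment> \<open>A repeated row would make the determinant vanish.\<close>
  have "v \<notin> r ` {..<k}"
  proof
    assume "v \<in> r ` {..<k}"
    then obtain i where i: "i < k" "v = r i" by auto
    have "Determinant.det (submat G (Suc k) ?r c) = 0"
      by (rule det_identical_rows[of _ "Suc k" i k]) (use i in \<open>auto intro!: eq_vecI\<close>)
    with det show False by simp
  qed
  then have "inj_on ?r {..<Suc k}"
    using r by (auto simp: inj_on_def less_Suc_eq)
  moreover have "?r ` {..<Suc k} \<subseteq> V"
    using r v by (auto simp: less_Suc_eq)
  ultimately show ?case using det Suc.prems(1) by blast
qed

text \<open>Cramer's rule with denominator \<open>\<plusminus>1\<close>.\<close>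

lemma totally_unimodular_integral_coefficients:
  fixes G :: "'v \<Rightarrow> 'e \<Rightarrow> int"
  assumes G: "totally_unimodular V E G" and I: "finite I" "I \<subseteq> E" "cols_independent V (rat_matrix G) I"
    and x: "\<And>v. v \<in> V \<Longrightarrow> rat_matrix G v e = (\<Sum>b\<in>I. x b * rat_matrix G v b)" and b: "b \<in> I"
  shows "x b \<in> \<int>"
proof -
  define k where "k = card I"
  obtain c where "bij_betw c {0..<k} I"
    using ex_bij_betw_nat_finite[OF I(1)] k_def by blast
  then have c: "inj_on c {..<k}" "c ` {..<k} = I"
    by (auto simp: bij_betw_def atLeast0LessThan)
  obtain r where r: "inj_on r {..<k}" "r ` {..<k} \<subseteq> V" "Determinant.det (submat G k r c) \<noteq> 0"
    using independent_cols_minor[of c k V G] c I by metis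
  let ?A = "submat G k r c"
  have A: "?A \<in> carrier_mat k k" by simp
  have "Determinant.det ?A \<in> {-1, 0, 1}"
    using G r c I unfolding totally_unimodular_def by blast
  with r have det: "Determinant.det ?A \<in> {-1, 1}" by auto
  obtain l where l: "l < k" "c l = b" using b c by force
  \<comment> \<open>These are the entries of row \<open>l\<close> of the adjugate. Combining the
    equations for the rows \<open>r i\<close> with them eliminates every coefficient except
    \<open>x b\<close>, which gets multiplied by the determinant.\<close>
  define a where "a i = adj_mat ?A $$ (l, i)" for i
  have "(\<Sum>i<k. a i * G (r i) (c j)) = (if j = l then Determinant.det ?A else 0)" if j: "j < k" for j
  proof -
    have "(adj_mat ?A * ?A) $$ (l, j) = (\<Sum>i<k. a i * G (r i) (c j))"
      using adj_mat(1)[OF A] l j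
      by (simp add: scalar_prod_def a_def atLeast0LessThan)
    moreover have "(adj_mat ?A * ?A) $$ (l, j) = (if j = l then Determinant.det ?A else 0)"
      using adj_mat(3)[OF A] l j by simp
    ultimately show ?thesis by simp
  qed
  then have adj: "(\<Sum>i<k. of_int (a i) * rat_matrix G (r i) (c j))
      = (if j = l then of_int (Determinant.det ?A) else 0)" if "j < k" for j
    using that by (simp add: rat_matrix_def flip: of_int_mult of_int_sum)
  have "(\<Sum>i<k. of_int (a i) * rat_matrix G (r i) e)
      = (\<Sum>i<k. of_int (a i) * (\<Sum>j<k. x (c j) * rat_matrix G (r i) (c j)))"
  proof (intro sum.cong refl)
    fix i assume "i \<in> {..<k}"
    then have "rat_matrix G (r i) e = (\<Sum>b\<in>I. x b * rat_matrix G (r i) b)"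
      using r x by blast
    also have "\<dots> = (\<Sum>j<k. x (c j) * rat_matrix G (r i) (c j))"
      using c by (intro sum.reindex_cong[of c]) auto
    finally show "of_int (a i) * rat_matrix G (r i) e
      = of_int (a i) * (\<Sum>j<k. x (c j) * rat_matrix G (r i) (c j))" by simp
  qed
  also have "\<dots> = (\<Sum>i<k. \<Sum>j<k. x (c j) * (of_int (a i) * rat_matrix G (r i) (c j)))"
    by (simp add: sum_distrib_left algebra_simps)
  also have "\<dots> = (\<Sum>j<k. \<Sum>i<k. x (c j) * (of_int (a i) * rat_matrix G (r i) (c j)))"
    by (rule sum.swap)
  also have "\<dots> = (\<Sum>j<k. x (c j) * (if j = l then of_int (Determinant.det ?A) else 0))"
    using adj by (simp add: sum_distrib_left[symmetric])
  also have "\<dots> = (\<Sum>j<k. if j = l then x b * of_int (Determinant.det ?A) else 0)"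
    using l by (intro sum.cong) auto
  also have "\<dots> = x b * of_int (Determinant.det ?A)"
    using l by simp
  finally have "x b * of_int (Determinant.det ?A) = of_int (\<Sum>i<k. a i * G (r i) e)"
    by (simp add: rat_matrix_def)
  then have "x b * of_int (Determinant.det ?A) \<in> \<int>" by (simp only: Ints_of_int)
  with det show ?thesis by (auto simp: minus_in_Ints_iff)
qed

section \<open>Vertex-edge matrices\<close>

text \<open>By induction on the size of the minor. If all its columns sum to zero, its rows add up
  to zero and the determinant vanishes. Otherwise some edge has exactly one end among the chosen
  vertices; its column has a single nonzero entry, and expansion along it leads to a smaller
  minor.\<close>

lemma vertex_edge_totally_unimodular:
  assumes "vertex_edge_matrix D V G" "E \<subseteq> arcs D"
  shows "totally_unimodular V E G"
proof -
  obtain vert where vert: "bij_betw vert V (verts D)"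
    and G: "\<And>v e. v \<in> V \<Longrightarrow> e \<in> E \<Longrightarrow> G v e = of_bool (head D e = vert v) - of_bool (tail D e = vert v)"
    using assms unfolding vertex_edge_matrix_def by blast
  have "Determinant.det (submat G k r c) \<in> {-1, 0, 1}"
    if "inj_on r {..<k}" "r ` {..<k} \<subseteq> V" "inj_on c {..<k}" "c ` {..<k} \<subseteq> E" for k r c
    using that
  proof (induction k arbitrary: r c)
    case 0
    then show ?case by simp
  next
    case (Suc k)
    let ?A = "submat G (Suc k) r c"
    have A: "?A \<in> carrier_mat (Suc k) (Suc k)" by simp
    have minor: "Determinant.det (mat_delete ?A i j) \<in> {-1, 0, 1}" if "i < Suc k" "j < Suc k" for i j
      unfolding mat_delete_submat
    proof (rule Suc.IH)
      have ins: "insert_index i ` {..<k} \<subseteq> {..<Suc k}" for i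
        by (auto simp: insert_index_def)
      show "inj_on (\<lambda>i'. r (insert_index i i')) {..<k}" "inj_on (\<lambda>j'. c (insert_index j j')) {..<k}"
        using comp_inj_on[OF insert_index_inj_on inj_on_subset[OF Suc.prems(1) ins]]
          comp_inj_on[OF insert_index_inj_on inj_on_subset[OF Suc.prems(3) ins]]
        by (simp_all add: o_def)
      show "(\<lambda>i'. r (insert_index i i')) ` {..<k} \<subseteq> V" "(\<lambda>j'. c (insert_index j j')) ` {..<k} \<subseteq> E"
        using Suc.prems ins by fastforce+
    qed
    show ?case
    proof (cases "\<forall>j<Suc k. (\<Sum>i<Suc k. G (r i) (c j)) = 0")
      case True
      let ?u = "Matrix.vec (Suc k) (\<lambda>_. 1 :: int)"
      have "transpose_mat ?A *\<^sub>v ?u = 0\<^sub>v (Suc k)"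
        using True by (intro eq_vecI) (auto simp: scalar_prod_def atLeast0LessThan)
      moreover have "?u \<noteq> 0\<^sub>v (Suc k)"
        by (metis index_vec index_zero_vec(1) zero_less_Suc zero_neq_one)
      ultimately have "Determinant.det (transpose_mat ?A) = 0"
        by (intro det_0_iff_vec_prod_zero[of _ "Suc k", THEN iffD2] exI[of _ ?u]) auto
      then show ?thesis using det_transpose[OF A] by simp
    next
      case False
      then obtain j where j: "j < Suc k" "(\<Sum>i<Suc k. G (r i) (c j)) \<noteq> 0" by blast
      let ?e = "c j"
      have e: "?e \<in> E" using j Suc.prems by auto
      have entry: "G (r i) ?e = of_bool (head D ?e = vert (r i)) - of_bool (tail D ?e = vert (r i))"
        if "i < Suc k" for i
        using that e Suc.prems by (intro G) auto
      have inj: "i = i'" if "vert (r i) = vert (r i')" "i < Suc k" "i' < Suc k" for i i'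
      proof -
        have "r i = r i'"
          using inj_onD[OF bij_betw_imp_inj_on[OF vert] that(1)] that Suc.prems(2) by blast
        with that Suc.prems(1) show ?thesis by (auto simp: inj_on_def)
      qed
      \<comment> \<open>The chosen vertices are distinct, so a vertex \<open>w\<close> is counted at
        most once.\<close>
      have cnt: "(\<Sum>i<Suc k. of_bool (w = vert (r i))) = (of_bool (\<exists>i<Suc k. w = vert (r i)) :: int)" for w
      proof (cases "\<exists>i<Suc k. w = vert (r i)")
        case True
        then obtain i0 where i0: "i0 < Suc k" "w = vert (r i0)" by blast
        have "(\<Sum>i<Suc k. of_bool (w = vert (r i))) = (\<Sum>i<Suc k. if i = i0 then 1 else 0 :: int)"
          using i0 inj by (intro sum.cong) auto
        with True i0 show ?thesis by simp
      qed auto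
      have "(\<Sum>i<Suc k. G (r i) ?e)
          = (\<Sum>i<Suc k. of_bool (head D ?e = vert (r i)) - of_bool (tail D ?e = vert (r i)))"
        using entry by (intro sum.cong) auto
      also have "\<dots> = of_bool (\<exists>i<Suc k. head D ?e = vert (r i)) - of_bool (\<exists>i<Suc k. tail D ?e = vert (r i))"
        by (simp only: sum_subtractf cnt)
      finally have ex: "(\<exists>i<Suc k. head D ?e = vert (r i)) \<noteq> (\<exists>i<Suc k. tail D ?e = vert (r i))"
        using j by (intro notI) simp
      then obtain i0 where i0: "i0 < Suc k" "head D ?e = vert (r i0) \<or> tail D ?e = vert (r i0)" by blast
      have zero: "G (r i) ?e = 0" if "i < Suc k" "i \<noteq> i0" for i
      proof -
        have "vert (r i) \<noteq> vert (r i0)" using inj that i0(1) by blast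
        then have "head D ?e \<noteq> vert (r i)" "tail D ?e \<noteq> vert (r i)"
          using i0 ex that(1) by auto
        with entry[OF that(1)] show ?thesis by simp
      qed
      have unit: "G (r i0) ?e \<in> {-1, 0, 1}"
        using entry[OF i0(1)] by auto
      have "Determinant.det ?A = (\<Sum>i<Suc k. ?A $$ (i, j) * cofactor ?A i j)"
        using j by (intro laplace_expansion_column) auto
      also have "\<dots> = (\<Sum>i<Suc k. if i = i0 then G (r i0) ?e * cofactor ?A i0 j else 0)"
        using zero j by (intro sum.cong) auto
      also have "\<dots> = G (r i0) ?e * cofactor ?A i0 j"
        using i0 by simp
      finally have "Determinant.det ?A = G (r i0) ?e * ((-1) ^ (i0 + j) * Determinant.det (mat_delete ?A i0 j))"
        by (simp add: cofactor_def)
      with unit minor[OF i0(1) j(1)] show ?thesis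
        by (auto simp: minus_one_power_iff)
    qed
  qed
  then show ?thesis unfolding totally_unimodular_def by blast
qed

section \<open>Cycle matrices\<close>

text \<open>The step \<open>(e, False)\<close> runs against the reference orientation, hence the
  sign.\<close>

definition step_value :: "('e \<Rightarrow> 'k::comm_ring_1) \<Rightarrow> 'e \<times> bool \<Rightarrow> 'k" where
  "step_value y a = (if snd a then y (fst a) else - y (fst a))"

abbreviation walk_sum :: "('e \<Rightarrow> 'k::comm_ring_1) \<Rightarrow> ('e \<times> bool) list \<Rightarrow> 'k" where
  "walk_sum y p \<equiv> (\<Sum>a\<leftarrow>p. step_value y a)"

text \<open>This is the signed incidence vector, in the shape of a row of a cycle-edge
  matrix.\<close>

definition traversal :: "('e \<times> bool) list \<Rightarrow> 'e \<Rightarrow> 'k::comm_ring_1" where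
  "traversal c e = of_bool ((e, True) \<in> set c) - of_bool ((e, False) \<in> set c)"

text \<open>Since no edge repeats, each edge is met in at most one direction. Orthogonality to a row
  of a cycle-edge matrix thus becomes the vanishing of a walk sum.\<close>

lemma sum_traversal:
  assumes "finite E" "distinct (map fst c)" "fst ` set c \<subseteq> E"
  shows "(\<Sum>e\<in>E. traversal c e * y e) = walk_sum y c"
  using assms(2,3)
proof (induction c)
  case Nil
  then show ?case by (simp add: traversal_def)
next
  case (Cons a c)
  have "traversal (a # c) e * y e = traversal c e * y e + (if e = fst a then step_value y a else 0)" for e
  proof (cases "e = fst a")
    case True
    with Cons.prems have "(e, True) \<notin> set c" "(e, False) \<notin> set c"
      by (force simp: image_iff)+
    with True show ?thesis
      by (cases a) (auto simp: traversal_def step_value_def)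
  qed (cases a, auto simp: traversal_def)
  with Cons assms(1) show ?case
    by (simp add: sum.distrib)
qed

section \<open>Walks and potentials\<close>

context wf_digraph
begin

lemma bidirected_simps [simp]:
  "verts (bidirected G) = verts G"
  "arcs (bidirected G) = arcs G \<times> UNIV"
  "tail (bidirected G) (e, b) = (if b then tail G e else head G e)"
  "head (bidirected G) (e, b) = (if b then head G e else tail G e)"
  by (simp_all add: bidirected_def)

lemma wf_bidirected: "wf_digraph (bidirected G)"
  by unfold_locales auto

end

text \<open>Directed walks of \<open>bidirected D\<close> are undirected walks of \<open>D\<close>;
  the prefix \<open>B\<close> gives access to the theory of walks for them.\<close>

locale bidirected_digraph = wf_digraph D for D :: "('n, 'e) pre_digraph"
begin

sublocale B: wf_digraph "bidirected D"
  by (rule wf_bidirected)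

text \<open>The potential differences telescope, also over steps taken backwards.\<close>

lemma walk_sum_potential:
  assumes "B.cas u p v"
  shows "walk_sum (\<lambda>e. \<pi> (head D e) - \<pi> (tail D e)) p = \<pi> v - \<pi> u"
  using assms
proof (induction p arbitrary: u)
  case (Cons a p)
  obtain e b where a: "a = (e, b)" by (cases a)
  show ?case using Cons.prems Cons.IH by (auto simp: a step_value_def)
qed simp

lemma awalk_append:
  "B.awalk u (p @ q) v \<longleftrightarrow> (\<exists>w. B.awalk u p w \<and> B.awalk w q v)"
  using B.awalk_appendI B.awalk_append_iff by blast

lemma awalk_reverse:
  assumes "B.awalk u p v"
  obtains p' where "B.awalk v p' u" "walk_sum y p' = - walk_sum y p"
  using assms
proof (induction p arbitrary: u thesis)
  case Nil
  then show ?case using Nil.prems(1)[of "[]"] by (auto simp: B.awalk_Nil_iff)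
next
  case (Cons a p)
  obtain e b where a: "a = (e, b)" by (cases a)
  have u: "e \<in> arcs D" "u = tail (bidirected D) (e, b)" "B.awalk (head (bidirected D) (e, b)) p v"
    using Cons.prems(2) by (auto simp: B.awalk_Cons_iff a)
  obtain p' where p': "B.awalk v p' (head (bidirected D) (e, b))" "walk_sum y p' = - walk_sum y p"
    using Cons.IH u(3) by blast
  have "B.awalk (head (bidirected D) (e, b)) [(e, \<not> b)] u"
    using u by (auto simp: B.awalk_Cons_iff B.awalk_Nil_iff)
  with p'(1) have "B.awalk v (p' @ [(e, \<not> b)]) u"
    using awalk_append by blast
  moreover have "walk_sum y (p' @ [(e, \<not> b)]) = - walk_sum y (a # p)"
    using p'(2) by (simp add: a step_value_def)
  ultimately show ?case by (rule Cons.prems(1))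
qed

text \<open>By induction on the length. A closed walk that repeats an edge or a vertex breaks up
  into shorter closed walks, apart from two opposite traversals of one edge, which cancel; a
  nonempty closed walk without repetition is a cycle.\<close>

lemma closed_walk_sum_zero:
  assumes "\<And>c. graph_cycle D c \<Longrightarrow> walk_sum y c = 0" and "B.awalk u p u"
  shows "walk_sum y p = 0"
  using assms(2)
proof (induction "length p" arbitrary: p u rule: less_induct)
  case less
  show ?case
  proof (cases "distinct (map fst p)")
    case False
    obtain xs ys zs e where "map fst p = xs @ [e] @ ys @ [e] @ zs"
      using not_distinct_decomp[OF False] by blast
    then obtain q p' where "p = q @ p'" "map fst p' = e # ys @ e # zs"
      by (auto simp: map_eq_append_conv)
    moreover from this(2) obtain b p'' where "p' = (e, b) # p''" "map fst p'' = ys @ e # zs"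
      by auto
    moreover from this(2) obtain r p3 where "p'' = r @ p3" "map fst p3 = e # zs"
      by (auto simp: map_eq_append_conv)
    moreover from this(2) obtain b' s where "p3 = (e, b') # s"
      by auto
    ultimately have p: "p = q @ (e, b) # r @ (e, b') # s"
      by simp
    let ?t = "tail (bidirected D)" and ?h = "head (bidirected D)"
    from less.prems have q: "B.awalk u q (?t (e, b))" and e: "e \<in> arcs D"
      and r: "B.awalk (?h (e, b)) r (?t (e, b'))" and s: "B.awalk (?h (e, b')) s u"
      unfolding p awalk_append B.awalk_Cons_iff by auto
    show ?thesis
    proof (cases "b = b'")
      case True
      have "B.awalk (?t (e, b)) ((e, b) # r) (?t (e, b))"
        using r e True by (simp only: B.awalk_Cons_iff) simp
      from less.hyps[OF _ this] have 1: "walk_sum y ((e, b) # r) = 0"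
        by (simp add: p)
      have "B.awalk u (q @ (e, b') # s) u"
        using q s e True unfolding awalk_append B.awalk_Cons_iff by auto
      from less.hyps[OF _ this] have "walk_sum y (q @ (e, b') # s) = 0"
        by (simp add: p)
      moreover have "walk_sum y p = walk_sum y ((e, b) # r) + walk_sum y (q @ (e, b') # s)"
        by (simp add: p algebra_simps)
      ultimately show ?thesis using 1 by simp
    next
      case False
      \<comment> \<open>Opposite directions: the part \<open>r\<close> between the two traversals is
        closed, and so is \<open>q @ s\<close>, which leaves them out.\<close>
      then have b': "b' = (\<not> b)" by auto
      have "B.awalk (?h (e, b)) r (?h (e, b))"
        using r by (simp add: b' split: if_splits)
      from less.hyps[OF _ this] have 1: "walk_sum y r = 0"
        by (simp add: p)
      have "?h (e, b') = ?t (e, b)"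
        by (simp add: b')
      with q s have "B.awalk u (q @ s) u"
        unfolding awalk_append by metis
      from less.hyps[OF _ this] have "walk_sum y (q @ s) = 0"
        by (simp add: p)
      moreover have "step_value y (e, b) + step_value y (e, b') = 0"
        by (simp add: step_value_def b')
      moreover have "walk_sum y p
          = walk_sum y (q @ s) + walk_sum y r + (step_value y (e, b) + step_value y (e, b'))"
        by (simp add: p algebra_simps)
      ultimately show ?thesis using 1 by simp
    qed
  next
    case True
    show ?thesis
    proof (cases "distinct (tl (B.awalk_verts u p)) \<or> p = []")
      case True
      then have "p = [] \<or> graph_cycle D p"
        using less.prems \<open>distinct (map fst p)\<close>
        by (auto simp: graph_cycle_def B.cycle_def)
      with assms(1) show ?thesis by auto
    next
      case False
      \<comment> \<open>The start vertex of a closed walk recurs at its end, so the repetition lies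
        among the vertices after the first step; it is located in the walk \<open>p'\<close> without
        that step.\<close>
      then obtain a p' where p: "p = a # p'" by (cases p) auto
      then have p': "a \<in> arcs (bidirected D)" "u = tail (bidirected D) a"
        "B.awalk (head (bidirected D) a) p' u"
        "\<not> distinct (B.awalk_verts (head (bidirected D) a) p')"
        using less.prems False by (auto simp: B.awalk_Cons_iff)
      obtain q r s w where d: "p' = q @ r @ s" "0 < length r"
        "B.awalk (head (bidirected D) a) q w" "B.awalk w r w" "B.awalk w s u"
        using B.awalk_not_distinct_decomp[OF p'(3,4)] by blast
      from less.hyps[OF _ d(4)] have 1: "walk_sum y r = 0"
        by (simp add: p d)
      have "B.awalk u (a # q @ s) u"
        using p' d(3,5) awalk_append[of "head (bidirected D) a" q s u] unfolding B.awalk_Cons_iff by blast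
      from less.hyps[OF _ this] have "walk_sum y (a # q @ s) = 0"
        using d(2) by (simp add: p d)
      with 1 show ?thesis by (simp add: p d)
    qed
  qed
qed

text \<open>The potential of a vertex is the walk sum from a chosen root of its component; two walks
  with the same ends have equal sums because one followed by the reverse of the other is
  closed.\<close>

lemma potential_exists:
  fixes y :: "'e \<Rightarrow> 'k::comm_ring_1"
  assumes "\<And>c. graph_cycle D c \<Longrightarrow> walk_sum y c = 0"
  obtains \<pi> where "\<And>e. e \<in> arcs D \<Longrightarrow> y e = \<pi> (head D e) - \<pi> (tail D e)"
proof -
  have indep: "walk_sum y p = walk_sum y q" if pq: "B.awalk u p v" "B.awalk u q v" for u v p q
  proof -
    obtain q' where q': "B.awalk v q' u" "walk_sum y q' = - walk_sum y q"
      using awalk_reverse[OF pq(2)] by blast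
    have "B.awalk u (p @ q') u"
      using pq(1) q'(1) awalk_append by blast
    from closed_walk_sum_zero[OF assms this] q'(2) show ?thesis by simp
  qed
  define root where "root v = (SOME u. \<exists>p. B.awalk u p v)" for v
  define \<pi> where "\<pi> v = walk_sum y (SOME p. B.awalk (root v) p v)" for v
  have root: "\<exists>p. B.awalk (root v) p v" if "v \<in> verts D" for v
    unfolding root_def
    by (rule someI[where P = "\<lambda>u. \<exists>p. B.awalk u p v"]) (use that in \<open>auto simp: B.awalk_Nil_iff intro!: exI[of _ "[]"]\<close>)
  have \<pi>: "\<pi> v = walk_sum y p" if "B.awalk (root v) p v" for v p
    unfolding \<pi>_def using that by (intro indep[OF _ that] someI)
  have "y e = \<pi> (head D e) - \<pi> (tail D e)" if e: "e \<in> arcs D" for e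
  proof -
    have fwd: "B.awalk (tail D e) [(e, True)] (head D e)"
      and bwd: "B.awalk (head D e) [(e, False)] (tail D e)"
      using e by (auto simp: B.awalk_Cons_iff B.awalk_Nil_iff)
    \<comment> \<open>Both ends of \<open>e\<close> are reached from the same vertices, so
      \<open>SOME\<close> selects the same root for them.\<close>
    have "(\<exists>p. B.awalk u p (tail D e)) \<longleftrightarrow> (\<exists>p. B.awalk u p (head D e))" for u
      using fwd bwd B.awalk_appendI by blast
    then have r: "root (tail D e) = root (head D e)"
      by (simp add: root_def)
    obtain p where p: "B.awalk (root (tail D e)) p (tail D e)"
      using root[of "tail D e"] e by auto
    then have "B.awalk (root (head D e)) (p @ [(e, True)]) (head D e)"
      using fwd B.awalk_appendI r by metis
    from \<pi>[OF this] \<pi>[OF p] show ?thesis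
      by (simp add: step_value_def)
  qed
  then show ?thesis by (rule that)
qed

end

section \<open>Circulations on a cycle and integrality for cycle matrices\<close>

lemma sum_list_of_bool_distinct:
  fixes g :: "'x \<Rightarrow> 'k::comm_ring_1"
  assumes "distinct (map f c)" "a \<in> set c"
  shows "(\<Sum>x\<leftarrow>c. g x * of_bool (f x = f a)) = g a"
proof -
  have "(\<Sum>x\<leftarrow>c. g x * of_bool (f x = f a)) = (\<Sum>x\<in>set c. g x * of_bool (f x = f a))"
    using assms by (intro sum_list_distinct_conv_sum_set) (simp add: distinct_map)
  also have "\<dots> = (\<Sum>x\<in>set c. if x = a then g a else 0)"
    using assms by (intro sum.cong) (auto simp: distinct_map inj_on_def)
  finally show ?thesis using assms by simp
qed

lemma constant_if_consecutive_eq: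
  assumes "\<And>xs a b ys. c = xs @ a # b # ys \<Longrightarrow> g a = g b" "x \<in> set c"
  shows "g x = g (hd c)"
  using assms
proof (induction c)
  case (Cons a c)
  have IH: "g x = g (hd c)" if "x \<in> set c"
    using Cons.prems(1)[of "_ # _"] by (intro Cons.IH that) simp
  show ?case
  proof (cases "x = a")
    case False
    with Cons.prems have x: "x \<in> set c" by simp
    then obtain b c' where "c = b # c'" by (cases c) auto
    with Cons.prems(1)[of "[]" a b c'] IH[OF x] show ?thesis by simp
  qed simp
qed simp

context bidirected_digraph
begin

text \<open>A circulation that is supported on a cycle takes the same value in every step of it, because
  no other arc of the support meets the vertex between two consecutive steps.\<close>

lemma circulation_on_cycle:
  fixes f :: "'e \<Rightarrow> 'k::comm_ring_1"
  assumes c: "graph_cycle D c" and E: "finite (arcs D)"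
    and f: "\<And>e. e \<in> arcs D \<Longrightarrow> e \<notin> fst ` set c \<Longrightarrow> f e = 0"
    and circ: "\<And>w. (\<Sum>e\<in>arcs D. f e * (of_bool (head D e = w) - of_bool (tail D e = w))) = 0"
    and a: "a \<in> set c"
  shows "step_value f a = step_value f (hd c)"
proof (rule constant_if_consecutive_eq[OF _ a])
  let ?t = "tail (bidirected D)" and ?h = "head (bidirected D)"
  obtain u where u: "B.awalk u c u" "distinct (tl (B.awalk_verts u c))" "c \<noteq> []"
    and d: "distinct (map fst c)"
    using c by (auto simp: graph_cycle_def B.cycle_def)
  have heads: "distinct (map ?h c)"
    using u B.awalk_verts_conv'[of u c u] by (auto simp: B.awalk_def)
  \<comment> \<open>The vertex sequence is read off once from the tails and once from the heads. As
    the walk is closed, tails and heads form the same multiset, so the tails are distinct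
    too.\<close>
  have "map ?t c @ [?h (last c)] = ?t (hd c) # map ?h c"
    using u B.awalk_verts_conv'[of u c u] B.awalk_verts_conv[of u c] by (auto simp: B.awalk_def)
  moreover have "?t (hd c) = u" "?h (last c) = u"
    using u B.awalk_verts_conv[of u c] B.awlast_of_awalk[OF u(1)] by (cases c; auto simp: B.awalk_def)+
  ultimately have "mset (map ?t c @ [u]) = mset (u # map ?h c)"
    by metis
  then have "mset (map ?t c) = mset (map ?h c)"
    by simp
  with heads have tails: "distinct (map ?t c)"
    using mset_eq_imp_distinct_iff by blast
  have sub: "fst ` set c \<subseteq> arcs D"
    using u by (auto simp: B.awalk_def)
  \<comment> \<open>Conservation at \<open>w\<close>, restricted to the cycle: what enters
    \<open>w\<close> along \<open>c\<close> equals what leaves it along \<open>c\<close>.\<close>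
  have net: "(\<Sum>x\<leftarrow>c. step_value f x * of_bool (?h x = w)) = (\<Sum>x\<leftarrow>c. step_value f x * of_bool (?t x = w))"
    for w
  proof -
    let ?F = "\<lambda>e. f e * (of_bool (head D e = w) - of_bool (tail D e = w))"
    have "(\<Sum>x\<leftarrow>c. step_value f x * of_bool (?h x = w)) - (\<Sum>x\<leftarrow>c. step_value f x * of_bool (?t x = w))
        = (\<Sum>x\<leftarrow>c. ?F (fst x))"
      unfolding sum_list_subtractf[symmetric]
    proof (intro arg_cong[of _ _ sum_list] map_cong refl)
      fix x
      show "step_value f x * of_bool (?h x = w) - step_value f x * of_bool (?t x = w) = ?F (fst x)"
        by (cases x; cases "snd x") (simp_all add: step_value_def algebra_simps)
    qed
    also have "\<dots> = (\<Sum>e\<leftarrow>map fst c. ?F e)"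
      by (simp add: o_def)
    also have "\<dots> = (\<Sum>e\<in>fst ` set c. ?F e)"
      using sum_list_distinct_conv_sum_set[OF d, of ?F] by simp
    also have "\<dots> = (\<Sum>e\<in>arcs D. ?F e)"
      using sub E f by (intro sum.mono_neutral_left) auto
    finally show ?thesis using circ by simp
  qed
  fix xs a b ys assume dec: "c = xs @ a # b # ys"
  then have ab: "a \<in> set c" "b \<in> set c" by auto
  have hab: "?h a = ?t b"
    using u(1) unfolding dec by (simp add: awalk_append B.awalk_Cons_iff)
  have "step_value f a = (\<Sum>x\<leftarrow>c. step_value f x * of_bool (?h x = ?h a))"
    by (rule sum_list_of_bool_distinct[OF heads ab(1), symmetric])
  also have "\<dots> = (\<Sum>x\<leftarrow>c. step_value f x * of_bool (?t x = ?t b))"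
    by (simp only: net hab)
  also have "\<dots> = step_value f b"
    by (rule sum_list_of_bool_distinct[OF tails ab(2)])
  finally show "step_value f a = step_value f b" .
qed

text \<open>The traversal vector of \<open>c'\<close> is a circulation supported on the edges of
  \<open>c\<close>, hence a multiple by a sign of that of \<open>c\<close>. This bridges the gap
  between all cycles and the one representative per edge set in a cycle-edge matrix.\<close>

lemma cycle_sum_zero_same_support:
  fixes y :: "'e \<Rightarrow> 'k::comm_ring_1"
  assumes c: "graph_cycle D c" "graph_cycle D c'" and E: "finite (arcs D)"
    and eq: "fst ` set c = fst ` set c'" and zero: "walk_sum y c' = 0"
  shows "walk_sum y c = 0"
proof -
  have cyc: "distinct (map fst c)" "fst ` set c \<subseteq> arcs D"
    if "graph_cycle D c" for c
    using that by (auto simp: graph_cycle_def B.cycle_def B.awalk_def)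
  \<comment> \<open>The potential is the indicator of \<open>w\<close>; its differences sum to zero
    around the closed walk \<open>c'\<close>.\<close>
  have circ: "(\<Sum>e\<in>arcs D. traversal c' e * (of_bool (head D e = w) - of_bool (tail D e = w))) = (0 :: 'k)" for w
  proof -
    obtain u where "B.cas u c' u"
      using c(2) by (auto simp: graph_cycle_def B.cycle_def B.awalk_def)
    from walk_sum_potential[OF this, of "\<lambda>v. of_bool (v = w)"] show ?thesis
      by (simp add: sum_traversal[OF E cyc[OF c(2)]])
  qed
  have out: "traversal c' e = (0 :: 'k)" if "e \<notin> fst ` set c" for e
    using that unfolding eq by (force simp: traversal_def image_iff)
  \<comment> \<open>The sign is 1 if \<open>c'\<close> takes the first step of \<open>c\<close> in
    the same direction, and -1 otherwise.\<close>
  define \<epsilon> where "\<epsilon> = step_value (traversal c' :: 'e \<Rightarrow> 'k) (hd c)"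
  have const: "step_value (traversal c') a = \<epsilon>" if "a \<in> set c" for a
    unfolding \<epsilon>_def using circulation_on_cycle[OF c(1) E out circ that] .
  have "traversal c' e = \<epsilon> * traversal c e" for e
  proof (cases "e \<in> fst ` set c")
    case True
    then obtain b where b: "(e, b) \<in> set c" by auto
    then have "(e, \<not> b) \<notin> set c"
      using cyc(1)[OF c(1)] by (force simp: distinct_map inj_on_def)
    with b const[OF b] show ?thesis
      by (cases b) (auto simp: step_value_def traversal_def[of c])
  next
    case False
    then have "traversal c e = (0 :: 'k)" by (force simp: traversal_def image_iff)
    with out[OF False] show ?thesis by simp
  qed
  moreover have "\<epsilon> * \<epsilon> = 1"
  proof -
    have ne: "c \<noteq> []" using c(1) by (auto simp: graph_cycle_def B.cycle_def)
    then have "hd c \<in> set c" by simp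
    then have "fst (hd c) \<in> fst ` set c'"
      unfolding eq[symmetric] by (rule imageI)
    then obtain b where b: "(fst (hd c), b) \<in> set c'"
      by auto
    then have "(fst (hd c), \<not> b) \<notin> set c'"
      using cyc(1)[OF c(2)] by (force simp: distinct_map inj_on_def)
    with b show ?thesis
      by (cases b) (auto simp: \<epsilon>_def step_value_def traversal_def)
  qed
  ultimately have "traversal c e = \<epsilon> * traversal c' e" for e
    by (simp add: mult.assoc[symmetric])
  then have "(\<Sum>e\<in>arcs D. traversal c e * y e) = \<epsilon> * (\<Sum>e\<in>arcs D. traversal c' e * y e)"
    by (simp add: sum_distrib_left mult.assoc)
  with zero show ?thesis
    by (simp add: sum_traversal[OF E cyc[OF c(1)]] sum_traversal[OF E cyc[OF c(2)]])
qed

text \<open>A relation between the columns is a vector of potential differences. Rounding the potential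
  down gives an integral relation with the same coefficient at \<open>e\<close> and no larger support, which
  coincides with the given one by independence.\<close>

lemma cycle_matrix_integral_coefficients:
  assumes G: "cycle_edge_matrix D V G" and E: "finite (arcs D)"
    and I: "I \<subseteq> arcs D" "cols_independent V (rat_matrix G) I" and e: "e \<in> arcs D" "e \<notin> I"
    and x: "\<And>v. v \<in> V \<Longrightarrow> rat_matrix G v e = (\<Sum>b\<in>I. x b * rat_matrix G v b)" and b: "b \<in> I"
  shows "x b \<in> \<int>"
proof -
  obtain cyc where cyc: "\<And>v. v \<in> V \<Longrightarrow> graph_cycle D (cyc v)"
    and bij: "bij_betw (\<lambda>v. fst ` set (cyc v)) V {fst ` set c |c. graph_cycle D c}"
    and Gv: "\<And>v e. v \<in> V \<Longrightarrow> e \<in> arcs D \<Longrightarrow> G v e = traversal (cyc v) e"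
    using G unfolding cycle_edge_matrix_def traversal_def by blast
  have finI: "finite I" using I(1) E by (rule finite_subset)
  have row: "(\<Sum>e\<in>arcs D. z e * rat_matrix G v e) = walk_sum z (cyc v)" if v: "v \<in> V" for z v
  proof -
    have "(\<Sum>e\<in>arcs D. z e * rat_matrix G v e) = (\<Sum>e\<in>arcs D. traversal (cyc v) e * z e)"
      using Gv[OF v] by (intro sum.cong) (auto simp: rat_matrix_def traversal_def)
    also have "\<dots> = walk_sum z (cyc v)"
      using cyc[OF v] by (intro sum_traversal E) (auto simp: graph_cycle_def B.cycle_def B.awalk_def)
    finally show ?thesis .
  qed
  define y where "y e' = (if e' = e then 1 else if e' \<in> I then - x e' else 0)" for e'
  have y_orth: "(\<Sum>e'\<in>arcs D. y e' * rat_matrix G v e') = 0" if v: "v \<in> V" for v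
  proof -
    have "(\<Sum>e'\<in>arcs D. y e' * rat_matrix G v e') = (\<Sum>e'\<in>insert e I. y e' * rat_matrix G v e')"
      using I e E by (intro sum.mono_neutral_right) (auto simp: y_def)
    also have "\<dots> = rat_matrix G v e + (\<Sum>b\<in>I. - (x b * rat_matrix G v b))"
      using e finI by (auto simp: y_def intro!: sum.cong)
    also have "\<dots> = 0" using x[OF v] by (simp add: sum_negf)
    finally show ?thesis .
  qed
  have "walk_sum y c = 0" if c: "graph_cycle D c" for c
  proof -
    have "fst ` set c \<in> (\<lambda>v. fst ` set (cyc v)) ` V"
      using bij_betw_imp_surj_on[OF bij] c by auto
    then obtain v where v: "v \<in> V" "fst ` set c = fst ` set (cyc v)" by auto
    have "walk_sum y (cyc v) = 0"
      using y_orth[OF v(1)] by (simp only: row[OF v(1)])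
    then show ?thesis
      by (rule cycle_sum_zero_same_support[OF c cyc[OF v(1)] E v(2)])
  qed
  then obtain \<pi> where \<pi>: "\<And>e. e \<in> arcs D \<Longrightarrow> y e = \<pi> (head D e) - \<pi> (tail D e)"
    using potential_exists by blast
  define z :: "'e \<Rightarrow> rat" where "z e' = of_int \<lfloor>\<pi> (head D e')\<rfloor> - of_int \<lfloor>\<pi> (tail D e')\<rfloor>" for e'
  have z_orth: "(\<Sum>e'\<in>arcs D. z e' * rat_matrix G v e') = 0" if v: "v \<in> V" for v
  proof -
    obtain u where "B.cas u (cyc v) u"
      using cyc[OF v] by (auto simp: graph_cycle_def B.cycle_def B.awalk_def)
    from walk_sum_potential[OF this, of "\<lambda>v. of_int \<lfloor>\<pi> v\<rfloor>"] show ?thesis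
      using row[OF v, of z] by (simp add: z_def[abs_def])
  qed
  have z_out: "z e' = 0" if "e' \<in> arcs D" "e' \<notin> I" "e' \<noteq> e" for e'
    using \<pi>[OF that(1)] that by (simp add: y_def z_def)
  \<comment> \<open>The potentials at the ends of \<open>e\<close> differ by an integer, so rounding
    preserves the difference.\<close>
  have "\<pi> (head D e) = \<pi> (tail D e) + 1"
    using \<pi>[OF e(1)] by (simp add: y_def)
  then have z_e: "z e = 1" by (simp add: z_def)
  have diff: "(\<Sum>b\<in>I. (y b - z b) * rat_matrix G v b) = 0" if v: "v \<in> V" for v
  proof -
    have "(\<Sum>b\<in>I. (y b - z b) * rat_matrix G v b) = (\<Sum>b\<in>arcs D. (y b - z b) * rat_matrix G v b)"
      using I E z_out z_e by (intro sum.mono_neutral_left) (auto simp: y_def)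
    also have "\<dots> = 0"
      using y_orth[OF v] z_orth[OF v] by (simp add: left_diff_distrib sum_subtractf)
    finally show ?thesis .
  qed
  have "y b = z b"
    using I(2)[unfolded cols_independent_def, rule_format, of "\<lambda>b. y b - z b" b] diff b by simp
  moreover have "y b = - x b" using b e by (auto simp: y_def)
  ultimately have "x b = - z b" by simp
  then show ?thesis by (simp add: z_def)
qed

end

section \<open>Integer matrices\<close>

lemma sum_const_lessThan_add:
  fixes a :: "'a::ab_group_add" and k l :: nat
  shows "(\<Sum>i<k + l. a) = (\<Sum>i<k. a) + (\<Sum>i<l. a)"
  by (induction l) (simp_all add: algebra_simps)

text \<open>Writing integers as differences of naturals spares the case distinction on signs in the
  module laws.\<close>

lemma int_scale_diff:
  "int_scale (int m - int n) a = (\<Sum>i<m. a) - (\<Sum>i<n. a)"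
proof (cases "n \<le> m")
  case True
  then obtain k where "m = n + k" using nat_le_iff_add by blast
  then show ?thesis by (simp add: int_scale_def sum_const_lessThan_add)
next
  case False
  then obtain k where "n = m + k" "0 < k" using less_imp_add_positive not_le by metis
  then show ?thesis by (simp add: int_scale_def sum_const_lessThan_add)
qed

lemma int_scale_zero_right [simp]: "int_scale n 0 = 0"
  by (simp add: int_scale_def)

lemma int_scale_one [simp]: "int_scale 1 a = a"
  by (simp add: int_scale_def)

lemma int_scale_add: "int_scale (x + y) a = int_scale x a + int_scale y a"
proof -
  obtain k l where x: "x = int k - int l" by (cases x rule: int_diff_cases)
  obtain k' l' where y: "y = int k' - int l'" by (cases y rule: int_diff_cases)
  have "x + y = int (k + k') - int (l + l')" by (simp add: x y)
  then show ?thesis by (simp only: x y int_scale_diff sum_const_lessThan_add) (simp add: algebra_simps)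
qed

lemma int_scale_add_right: "int_scale x (a + b) = int_scale x a + int_scale x b"
  by (simp add: int_scale_def sum.distrib)

lemma int_scale_minus: "int_scale (- x) a = - int_scale x a"
  using int_scale_add[of x "- x" a] by (simp add: int_scale_def[of 0] eq_neg_iff_add_eq_0 add.commute)

lemma int_scale_mult: "int_scale (x * y) a = int_scale x (int_scale y a)"
proof (induction x rule: int_induct[of _ 0])
  case base
  show ?case by (simp add: int_scale_def)
next
  case (step1 i)
  then show ?case by (simp add: distrib_right int_scale_add)
next
  case (step2 i)
  have "int_scale ((i - 1) * y) a = int_scale (i * y + - y) a"
    by (simp add: algebra_simps)
  also have "\<dots> = int_scale i (int_scale y a) - int_scale y a"
    by (simp only: int_scale_add int_scale_minus step2) simp
  also have "\<dots> = int_scale (i + - 1) (int_scale y a)"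
    by (simp only: int_scale_add int_scale_minus int_scale_one) simp
  finally show ?case by simp
qed

lemma module_int_scale: "Modules.module int_scale"
  by unfold_locales (simp_all add: int_scale_add int_scale_add_right int_scale_mult)

text \<open>Translation by \<open>a\<close> permutes the group, so it does not change the sum of all elements.\<close>

lemma int_scale_card:
  fixes a :: "'a::{ab_group_add, finite}"
  shows "int_scale (int CARD('a)) a = 0"
proof -
  have "(\<Sum>x\<in>UNIV. x + a) = (\<Sum>x\<in>UNIV. x)"
    by (rule sum.reindex_bij_witness[of _ "\<lambda>x. x - a" "\<lambda>x. x + a"]) auto
  then have "(\<Sum>x::'a\<in>UNIV. a) = 0"
    by (simp add: sum.distrib)
  moreover have "(\<Sum>x::'a\<in>UNIV. a) = (\<Sum>i<CARD('a). a)"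
  proof -
    obtain f where "bij_betw f {0..<CARD('a)} (UNIV :: 'a set)"
      using ex_bij_betw_nat_finite[of "UNIV :: 'a set"] by auto
    from sum.reindex_bij_betw[OF this, of "\<lambda>_. a"] show ?thesis
      by (simp add: atLeast0LessThan)
  qed
  ultimately show ?thesis by (simp add: int_scale_def)
qed

text \<open>The order of the group annihilates it, so by Bezout's identity \<open>m\<close> acts
  invertibly.\<close>

lemma int_scale_coprime_zero:
  fixes a :: "'a::{ab_group_add, finite}"
  assumes "coprime m (int CARD('a))" "int_scale m a = 0"
  shows "a = 0"
proof -
  obtain u v where uv: "u * m + v * int CARD('a) = 1"
    using assms(1) bezout_int[of m "int CARD('a)"] by auto
  have "a = int_scale (u * m + v * int CARD('a)) a" by (simp add: uv)
  also have "\<dots> = 0"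
    by (simp add: int_scale_add int_scale_mult int_scale_card assms(2))
  finally show ?thesis .
qed

section \<open>Row maps and flows of integer matrices\<close>

text \<open>Rational relations suffice for independence, and by the hypothesis \<open>int\<close>
  the rational coefficients of a dependent column are integers, so taking floors does not change
  them.\<close>

lemma module_matrix_integral:
  fixes G :: "'v \<Rightarrow> 'e \<Rightarrow> int"
  assumes E: "finite E"
    and int: "\<And>I e x. I \<subseteq> E \<Longrightarrow> cols_independent V (rat_matrix G) I \<Longrightarrow> e \<in> E \<Longrightarrow> e \<notin> I \<Longrightarrow>
      (\<And>v. v \<in> V \<Longrightarrow> rat_matrix G v e = (\<Sum>b\<in>I. x b * rat_matrix G v b)) \<Longrightarrow> x ` I \<subseteq> \<int>"
  shows "module_matrix (int_scale :: int \<Rightarrow> 'a::ab_group_add \<Rightarrow> 'a) E V G (rat_matrix G)"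
proof (intro module_matrix.intro module_int_scale module_matrix_axioms.intro E)
  fix I c b
  assume I: "cols_independent V (rat_matrix G) I" and b: "b \<in> I"
    and c: "\<And>v. v \<in> V \<Longrightarrow> (\<Sum>b\<in>I. c b * G v b) = 0"
  have "(\<Sum>b\<in>I. of_int (c b) * rat_matrix G v b) = 0" if "v \<in> V" for v
    using c[OF that] by (simp add: rat_matrix_def flip: of_int_mult of_int_sum)
  then have "of_int (c b) = (0 :: rat)"
    using I[unfolded cols_independent_def, rule_format, of "\<lambda>b. of_int (c b)" b] b by simp
  then show "c b = 0" by simp
next
  fix I e
  assume I: "I \<subseteq> E" "cols_independent V (rat_matrix G) I" and e: "e \<in> E"
    and dep: "\<not> cols_independent V (rat_matrix G) (insert e I)"
  have eI: "e \<notin> I" using I dep by (auto simp: insert_absorb)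
  obtain x where x: "\<And>v. v \<in> V \<Longrightarrow> rat_matrix G v e = (\<Sum>b\<in>I. x b * rat_matrix G v b)"
    using dependent_column_combination[OF finite_subset[OF I(1) E] I(2) dep] by blast
  have xi: "x b = of_int \<lfloor>x b\<rfloor>" if "b \<in> I" for b
    using int[OF I e eI x] that by (auto elim!: Ints_cases dest!: subsetD)
  have "G v e = (\<Sum>b\<in>I. \<lfloor>x b\<rfloor> * G v b)" if v: "v \<in> V" for v
  proof -
    have "of_int (G v e) = (\<Sum>b\<in>I. of_int \<lfloor>x b\<rfloor> * rat_matrix G v b)"
      unfolding rat_matrix_def[of G v e, symmetric] x[OF v]
      using xi by (intro sum.cong refl arg_cong2[of _ _ _ _ "(*)"])
    also have "\<dots> = of_int (\<Sum>b\<in>I. \<lfloor>x b\<rfloor> * G v b)"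
      by (simp add: rat_matrix_def)
    finally show ?thesis by (simp only: of_int_eq_iff)
  qed
  then show "\<exists>c. \<forall>v\<in>V. G v e = (\<Sum>b\<in>I. c b * G v b)"
    by (intro exI[of _ "\<lambda>b. \<lfloor>x b\<rfloor>"] ballI)
qed

text \<open>Some multiple of a relation \<open>y\<close> by a factor \<open>m\<close> prime to the
  group order is an integer combination of rows of \<open>H\<close> and thus annihilates every flow;
  the factor \<open>m\<close> can be cancelled in the group.\<close>

lemma flows_eq_row_maps_int:
  fixes G :: "'v \<Rightarrow> 'e \<Rightarrow> int" and H :: "'w \<Rightarrow> 'e \<Rightarrow> int"
  assumes dual: "integrally_dual CARD('a) E V G W H" and fin: "finite E" "finite W"
  shows "flows int_scale E W H = (row_maps int_scale E V G :: ('e \<Rightarrow> 'a::{ab_group_add, finite}) set)"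
proof (rule antisym)
  interpret Modules.module "int_scale :: int \<Rightarrow> 'a \<Rightarrow> 'a" by (rule module_int_scale)
  have "(\<Sum>e\<in>E. G v e * H w e) = 0" if "v \<in> V" "w \<in> W" for v w
  proof -
    have "of_int (\<Sum>e\<in>E. G v e * H w e) = (\<Sum>e\<in>E. rat_matrix G v e * rat_matrix H w e)"
      by (simp add: rat_matrix_def)
    also have "\<dots> = 0"
      using dual that by (auto simp: integrally_dual_def orthogonally_dual_def)
    finally show ?thesis by (simp only: of_int_eq_0_iff)
  qed
  then show "row_maps int_scale E V G \<subseteq> (flows int_scale E W H :: ('e \<Rightarrow> 'a) set)"
    by (rule row_maps_subset_flows)
  show "flows int_scale E W H \<subseteq> (row_maps int_scale E V G :: ('e \<Rightarrow> 'a) set)"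
  proof
    fix h :: "'e \<Rightarrow> 'a" assume h: "h \<in> flows int_scale E W H"
    have "(\<Sum>e\<in>E. int_scale (y e) (h e)) = 0" if y: "\<forall>v\<in>V. (\<Sum>e\<in>E. G v e * y e) = 0" for y
    proof -
      obtain m c where m: "coprime m (int CARD('a))"
        and c: "\<And>e. e \<in> E \<Longrightarrow> m * y e = (\<Sum>w\<in>W. c w * H w e)"
        using dual y unfolding integrally_dual_def by blast
      have "int_scale m (\<Sum>e\<in>E. int_scale (y e) (h e)) = (\<Sum>e\<in>E. int_scale (\<Sum>w\<in>W. c w * H w e) (h e))"
        using c by (simp add: scale_sum_right)
      also have "\<dots> = (\<Sum>e\<in>E. \<Sum>w\<in>W. int_scale (c w) (int_scale (H w e) (h e)))"
        by (simp add: scale_sum_left)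
      also have "\<dots> = (\<Sum>w\<in>W. \<Sum>e\<in>E. int_scale (c w) (int_scale (H w e) (h e)))"
        by (rule sum.swap)
      also have "\<dots> = (\<Sum>w\<in>W. int_scale (c w) (\<Sum>e\<in>E. int_scale (H w e) (h e)))"
        by (simp add: scale_sum_right)
      also have "\<dots> = 0" using h by (simp add: flows_def)
      finally show ?thesis using int_scale_coprime_zero[OF m] by blast
    qed
    with h show "h \<in> row_maps int_scale E V G"
      by (auto simp: flows_def row_maps_def)
  qed
qed

section \<open>Matrices over a finite field\<close>

lemma module_vec: "Modules.module ((*s) :: 'f::field \<Rightarrow> 'f ^ 'd::finite \<Rightarrow> 'f ^ 'd)"
  by unfold_locales (simp_all add: vector_add_ldistrib vector_sadd_rdistrib vector_smult_assoc)

lemma module_matrix_field: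
  fixes G :: "'v \<Rightarrow> 'e \<Rightarrow> 'f::field"
  assumes "finite E"
  shows "module_matrix ((*s) :: 'f \<Rightarrow> 'f ^ 'd::finite \<Rightarrow> 'f ^ 'd) E V G G"
proof (intro module_matrix.intro module_vec module_matrix_axioms.intro assms)
  show "c b = 0" if "cols_independent V G I" "\<And>v. v \<in> V \<Longrightarrow> (\<Sum>b\<in>I. c b * G v b) = 0" "b \<in> I" for I c b
    using that unfolding cols_independent_def by blast
  show "\<exists>c. \<forall>v\<in>V. G v e = (\<Sum>b\<in>I. c b * G v b)"
    if "I \<subseteq> E" "cols_independent V G I" "\<not> cols_independent V G (insert e I)" for I e
    using dependent_column_combination[OF finite_subset[OF that(1) assms] that(2,3)] by metis
qed

text \<open>The row maps are contained in the flows, and their number is the group order to the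
  power \<open>matroid_rank V G E\<close>, which is the upper bound for the number of flows because
  the ranks are complementary.\<close>

lemma flows_eq_row_maps_field:
  fixes G :: "'v \<Rightarrow> 'e \<Rightarrow> 'f::field" and H :: "'w \<Rightarrow> 'e \<Rightarrow> 'f"
  assumes dual: "orthogonally_dual E V G W H" and E: "finite E"
    and fin: "finite (UNIV :: ('f ^ 'd::finite) set)"
  shows "flows (*s) E W H = (row_maps (*s) E V G :: ('e \<Rightarrow> 'f ^ 'd) set)"
proof -
  let ?T = "row_maps (*s) E V G :: ('e \<Rightarrow> 'f ^ 'd) set"
  let ?F = "flows (*s) E W H :: ('e \<Rightarrow> 'f ^ 'd) set"
  interpret module_matrix "(*s) :: 'f \<Rightarrow> 'f ^ 'd \<Rightarrow> 'f ^ 'd" E V G G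
    by (rule module_matrix_field[OF E])
  have sub: "?T \<subseteq> ?F"
    using dual by (intro row_maps_subset_flows) (auto simp: orthogonally_dual_def)
  have "?F \<subseteq> E \<rightarrow>\<^sub>E UNIV" by (auto simp: flows_def)
  then have finF: "finite ?F"
    by (rule finite_subset) (intro finite_PiE E fin)
  have "matroid_rank V G {} = 0"
    using matroid_rank_le_card[of "{}" V G] by simp
  then have "card ?T = CARD('f ^ 'd) ^ matroid_rank V G E"
    using card_row_maps_rank[OF empty_subsetI fin] by simp
  also have "matroid_rank V G E = card E - matroid_rank W H E"
    using dual by (auto simp: orthogonally_dual_def)
  finally have "card ?F \<le> card ?T"
    using card_flows_le[OF E fin] by metis
  then show ?thesis using card_seteq[OF finF sub] by simp
qed

section \<open>The enumerators\<close>

lemma flow_enumerators: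
  fixes F :: "('e \<Rightarrow> 'a::zero) set"
  assumes E: "finite E" and F: "finite F"
    and rk: "\<And>B. B \<subseteq> E \<Longrightarrow> rk B \<le> rk E" "\<And>B. B \<subseteq> E \<Longrightarrow> rk B \<le> card B"
    and cnt: "\<And>B. B \<subseteq> E \<Longrightarrow> card {h \<in> F. \<forall>e\<in>B. h e = 0} = q ^ (rk E - rk B)"
    and \<omega>: "\<sigma> > 1" "primitive_root_of_unity \<sigma> \<omega>"
  shows "(\<Sum>k = 0..\<sigma> - 1. \<omega> ^ k * of_nat (card (flows_mod E F k \<sigma>)))
      = \<omega> ^ (card E - rk E) * (1 - \<omega>) ^ rk E * rank_poly E rk (of_nat q * \<omega> / (1 - \<omega>)) ((1 - \<omega>) / \<omega>)"
    and "Sum_any (\<lambda>k. of_nat (card (flows_inf E F k)) * indet ^ k)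
      = indet ^ (card E - rk E) * (1 - indet) ^ rk E *
        rank_poly E rk (of_nat q * indet / (1 - indet)) ((1 - indet) / indet)"
proof -
  \<comment> \<open>Primitivity at exponent 1, which is below \<open>\<sigma>\<close>, excludes
    \<open>\<omega> = 1\<close>; the denominators in the formula are thus nonzero.\<close>
  have root: "\<omega> ^ \<sigma> = 1" and ne1: "\<omega> \<noteq> 1"
    using \<omega> by (auto simp: primitive_root_of_unity_def dest: spec[of _ 1])
  have ne0: "\<omega> \<noteq> 0"
    using root \<omega>(1) by (auto simp: power_0_left)
  show "(\<Sum>k = 0..\<sigma> - 1. \<omega> ^ k * of_nat (card (flows_mod E F k \<sigma>)))
      = \<omega> ^ (card E - rk E) * (1 - \<omega>) ^ rk E * rank_poly E rk (of_nat q * \<omega> / (1 - \<omega>)) ((1 - \<omega>) / \<omega>)"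
    using sum_flows_mod[OF F root] \<omega>(1) support_enumerator[OF E F ne0 ne1 rk cnt] by simp
  have X: "indet \<noteq> 0" "indet \<noteq> 1"
    by (simp_all add: indet_def Zero_fract_def One_fract_def eq_fract one_pCons)
  then show "Sum_any (\<lambda>k. of_nat (card (flows_inf E F k)) * indet ^ k)
      = indet ^ (card E - rk E) * (1 - indet) ^ rk E *
        rank_poly E rk (of_nat q * indet / (1 - indet)) ((1 - indet) / indet)"
    unfolding Sum_any_flows_inf[OF E F] using support_enumerator[OF E F X rk cnt] by blast
qed

lemma integer_flow_enumerators:
  fixes G :: "'v \<Rightarrow> 'e \<Rightarrow> int" and \<H> :: "('e \<Rightarrow> 'a::{ab_group_add, finite}) set"
  assumes \<sigma>: "\<sigma> > 1" "primitive_root_of_unity \<sigma> \<omega>" and X: "X = indet"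
    and E: "finite E" and W: "finite W"
    and G: "fin_digraph D \<and> arcs D = E \<and> (vertex_edge_matrix D V G \<or> cycle_edge_matrix D V G)
      \<or> totally_unimodular V E G"
    and q: "q = CARD('a)" and dual: "integrally_dual q E V G W H"
    and \<H>: "\<H> = flows int_scale E W H" and r: "r = matroid_rank V (rat_matrix G) E"
  shows "(\<Sum>k = 0..\<sigma> - 1. \<omega> ^ k * of_nat (card (flows_mod E \<H> k \<sigma>)))
      = \<omega> ^ (card E - r) * (1 - \<omega>) ^ r *
        rank_poly E (matroid_rank V (rat_matrix G)) (of_nat q * \<omega> / (1 - \<omega>)) ((1 - \<omega>) / \<omega>)
    \<and> Sum_any (\<lambda>k. of_nat (card (flows_inf E \<H> k)) * X ^ k)
      = X ^ (card E - r) * (1 - X) ^ r *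
        rank_poly E (matroid_rank V (rat_matrix G)) (of_nat q * X / (1 - X)) ((1 - X) / X)"
proof -
  have integral: "x ` I \<subseteq> \<int>" if x: "I \<subseteq> E" "cols_independent V (rat_matrix G) I" "e \<in> E" "e \<notin> I"
    "\<And>v. v \<in> V \<Longrightarrow> rat_matrix G v e = (\<Sum>b\<in>I. x b * rat_matrix G v b)" for I e x
  \<comment> \<open>Vertex-edge matrices join the totally unimodular case; cycle-edge matrices
    remain.\<close>
  proof (cases "totally_unimodular V E G \<or> vertex_edge_matrix D V G \<and> E = arcs D")
    case True
    then have "totally_unimodular V E G"
      using vertex_edge_totally_unimodular[of D V G E] by auto
    then show ?thesis
      using totally_unimodular_integral_coefficients[OF _ finite_subset[OF x(1) E] x(1,2,5)] by blast
  next
    case False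
    then have D: "fin_digraph D" "arcs D = E" "cycle_edge_matrix D V G" using G by auto
    then interpret bidirected_digraph D
      by (simp add: bidirected_digraph_def fin_digraph_def)
    show ?thesis
      using cycle_matrix_integral_coefficients[OF D(3), of I e x] x E by (auto simp: D(2))
  qed
  interpret module_matrix "int_scale :: int \<Rightarrow> 'a \<Rightarrow> 'a" E V G "rat_matrix G"
    by (rule module_matrix_integral[OF E integral])
  have F: "\<H> = row_maps int_scale E V G"
    unfolding \<H> using flows_eq_row_maps_int[OF dual[unfolded q] E W] .
  have "finite (E \<rightarrow>\<^sub>E (UNIV :: 'a set))"
    using E by (intro finite_PiE) auto
  then have fin: "finite \<H>"
    by (rule finite_subset[rotated]) (auto simp: F row_maps_def)
  have cnt: "card {h \<in> \<H>. \<forall>e\<in>B. h e = 0}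
      = q ^ (matroid_rank V (rat_matrix G) E - matroid_rank V (rat_matrix G) B)" if "B \<subseteq> E" for B
    unfolding F q using that by (rule card_row_maps_rank) simp
  note enum = flow_enumerators[OF E fin matroid_rank_mono[OF E]
      matroid_rank_le_card[OF finite_subset[OF _ E]] cnt \<sigma>]
  show ?thesis unfolding r X using enum by blast
qed

lemma field_flow_enumerators:
  fixes G :: "'v \<Rightarrow> 'e \<Rightarrow> 'f::field" and \<H> :: "('e \<Rightarrow> 'f ^ 'd::finite) set"
  assumes \<sigma>: "\<sigma> > 1" "primitive_root_of_unity \<sigma> \<omega>" and X: "X = indet" and E: "finite E"
    and p: "prime p" "CARD('f) = p ^ s" and q: "q = p ^ (s * CARD('d))"
    and dual: "orthogonally_dual E V G W H"
    and \<H>: "\<H> = flows (*s) E W H" and r: "r = matroid_rank V G E"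
  shows "(\<Sum>k = 0..\<sigma> - 1. \<omega> ^ k * of_nat (card (flows_mod E \<H> k \<sigma>)))
      = \<omega> ^ (card E - r) * (1 - \<omega>) ^ r *
        rank_poly E (matroid_rank V G) (of_nat q * \<omega> / (1 - \<omega>)) ((1 - \<omega>) / \<omega>)
    \<and> Sum_any (\<lambda>k. of_nat (card (flows_inf E \<H> k)) * X ^ k)
      = X ^ (card E - r) * (1 - X) ^ r *
        rank_poly E (matroid_rank V G) (of_nat q * X / (1 - X)) ((1 - X) / X)"
proof -
  have "0 < CARD('f)" using p by (simp add: prime_gt_0_nat)
  then have finf: "finite (UNIV :: 'f set)" by (simp add: card_gt_0_iff)
  have vec: "bij_betw vec_nth (UNIV :: ('f ^ 'd) set) (UNIV \<rightarrow>\<^sub>E UNIV)"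
    by (rule bij_betwI[of _ _ _ vec_lambda]) auto
  have finv: "finite (UNIV :: ('f ^ 'd) set)"
    unfolding bij_betw_finite[OF vec] by (intro finite_PiE finf finite)
  have card: "CARD('f ^ 'd) = q"
    unfolding bij_betw_same_card[OF vec] by (subst card_PiE) (simp_all add: p q power_mult)
  interpret module_matrix "(*s) :: 'f \<Rightarrow> 'f ^ 'd \<Rightarrow> 'f ^ 'd" E V G G
    by (rule module_matrix_field[OF E])
  have F: "\<H> = row_maps (*s) E V G"
    unfolding \<H> using flows_eq_row_maps_field[OF dual E finv] .
  have "finite (E \<rightarrow>\<^sub>E (UNIV :: ('f ^ 'd) set))"
    using E finv by (intro finite_PiE) auto
  then have fin: "finite \<H>"
    by (rule finite_subset[rotated]) (auto simp: F row_maps_def)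
  have cnt: "card {h \<in> \<H>. \<forall>e\<in>B. h e = 0} = q ^ (matroid_rank V G E - matroid_rank V G B)"
    if "B \<subseteq> E" for B
    unfolding F card[symmetric] using that finv by (rule card_row_maps_rank)
  note enum = flow_enumerators[OF E fin matroid_rank_mono[OF E]
      matroid_rank_le_card[OF finite_subset[OF _ E]] cnt \<sigma>]
  show ?thesis unfolding r X using enum by blast
qed

section \<open>Both cases of the setting together\<close>

theorem theorem7p3:
  fixes \<sigma> :: nat and \<omega> :: complex and X :: "int poly fract"
    and E :: "'e set" and V :: "'v set" and W :: "'w set"
    and q r :: nat
    \<comment> \<open>case (i)\<close>
    and D :: "('n, 'e) pre_digraph"
    and G :: "'v \<Rightarrow> 'e \<Rightarrow> int" and H :: "'w \<Rightarrow> 'e \<Rightarrow> int"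
    and \<H> :: "('e \<Rightarrow> 'a::{ab_group_add, finite}) set"
    \<comment> \<open>case (ii)\<close>
    and p s :: nat
    and G' :: "'v \<Rightarrow> 'e \<Rightarrow> 'f::field" and H' :: "'w \<Rightarrow> 'e \<Rightarrow> 'f::field"
    and \<H>' :: "('e \<Rightarrow> 'f ^ 'd::finite) set"
  assumes "\<sigma> > 1" and "primitive_root_of_unity \<sigma> \<omega>" and "X = indet"
    and "finite E" and "finite V" and "finite W"
  shows
    "((fin_digraph D \<and> arcs D = E \<and> (vertex_edge_matrix D V G \<or> cycle_edge_matrix D V G)
         \<or> totally_unimodular V E G)
      \<and> q = CARD('a)
      \<and> integrally_dual q E V G W H
      \<and> \<H> = flows int_scale E W H
      \<and> r = matroid_rank V (rat_matrix G) E
      \<longrightarrow>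
        (\<Sum>k = 0..\<sigma> - 1. \<omega> ^ k * of_nat (card (flows_mod E \<H> k \<sigma>)))
          = \<omega> ^ (card E - r) * (1 - \<omega>) ^ r *
            rank_poly E (matroid_rank V (rat_matrix G))
              (of_nat q * \<omega> / (1 - \<omega>)) ((1 - \<omega>) / \<omega>)
      \<and> Sum_any (\<lambda>k. of_nat (card (flows_inf E \<H> k)) * X ^ k)
          = X ^ (card E - r) * (1 - X) ^ r *
            rank_poly E (matroid_rank V (rat_matrix G))
              (of_nat q * X / (1 - X)) ((1 - X) / X))
   \<and> (prime p \<and> 0 < s \<and> CARD('f) = p ^ s
      \<and> q = p ^ (s * CARD('d))
      \<and> orthogonally_dual E V G' W H'
      \<and> \<H>' = flows (*s) E W H'
      \<and> r = matroid_rank V G' E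
      \<longrightarrow>
        (\<Sum>k = 0..\<sigma> - 1. \<omega> ^ k * of_nat (card (flows_mod E \<H>' k \<sigma>)))
          = \<omega> ^ (card E - r) * (1 - \<omega>) ^ r *
            rank_poly E (matroid_rank V G')
              (of_nat q * \<omega> / (1 - \<omega>)) ((1 - \<omega>) / \<omega>)
      \<and> Sum_any (\<lambda>k. of_nat (card (flows_inf E \<H>' k)) * X ^ k)
          = X ^ (card E - r) * (1 - X) ^ r *
            rank_poly E (matroid_rank V G')
              (of_nat q * X / (1 - X)) ((1 - X) / X))"
  by (rule conjI; rule impI; elim conjE;
      (rule integer_flow_enumerators[OF assms(1-4,6)] | rule field_flow_enumerators[OF assms(1-4)]);
      assumption)

end
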